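(* Assume (P1)–(P6). Let $d=d_y+d_x$ and $s=1+1/\beta+1/\tau$, where $\beta,\tau>0$ are given constants. Let $$t_0>\frac{ds+\max\{\tau_1,1,\tau_2/\tau\}}{2+d/\beta},\qquad \epsilon_n=n^{-\beta/(2\beta+d)}(\log n)^t,\qquad \tilde\epsilon_n=n^{-\beta/(2\beta+d)}(\log n)^{t_0}.$$ Define $\mathcal F_n$ as the sieve $$\{p(y|x,\theta,m):m\le H,\ \alpha_j\ge\underline\alpha,\ \sigma\in[\underline\sigma,\overline\sigma],\ \mu^y_j\in[-\overline\mu,\overline\mu]^{d_y},\ j\le m\}$$ with $$H=n\epsilon_n^2/\log n,\quad \underline\alpha=e^{-nH},\quad \underline\sigma=n^{-1/(2a_3)},\quad \overline\sigma=e^n,\quad \overline\mu=n^{1/\tau_3}.$$ Let $\rho$ be $d_h$ or $d_1$. Then for all $t>t_0+\max\{0,(1-\tau_1)/2\}$ there exist constants $c_1,c_3>0$ such that, for every $c_2>0$ and all sufficiently large $n$, $$\log J(\epsilon_n,\mathcal F_n,\rho)\le c_1n\epsilon_n^2\qquad\text{and}\qquad \Pi(\mathcal F_n^c)\le c_3\exp\{-(c_2+4)n\tilde\epsilon_n^2\}.$$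
   Context: **Spaces and model.** Let $\mathcal Y\subset\mathbb R^{d_y}$ and $\mathcal X=[0,1]^{d_x}$. $\mathcal F$ is the set of Borel measurable $f:\mathcal Y\times\mathcal X\to[0,\infty)$ with $\int f(y|x)\,dy=1$ for all $x$. $g_0$ is a Lebesgue density on $\mathcal X$. **Distances.** $d_h(f_1,f_2)=(\int(\sqrt{f_1}-\sqrt{f_2})^2g_0\,dy\,dx)^{1/2}$ and $d_1(f_1,f_2)=\int|f_1-f_2|g_0\,dy\,dx$. $J(\epsilon,A,\rho)$ is the $\epsilon$-covering number. **Model.** The model is $$p(y|x,\theta,m)=\sum_{j=1}^m\frac{\alpha_j\exp\{-0.5\|x-\mu^x_j\|^2/\sigma^2\}}{\sum_{i}\alpha_i\exp\{-0.5\|x-\mu^x_i\|^2/\sigma^2\}}\phi_{\mu^y_j,\sigma}(y),$$ where $\phi_{\mu,\sigma}$ is the normal density with covariance $\sigma^2I$. The parameters satisfy $\mu^x_j\in\mathcal X$, $\alpha\in\Delta^{m-1}$, $\mu^y_j\in\mathbb R^{d_y}$, $\sigma>0$. **Prior $\Pi$.** The constants $a,a_i$ are positive. - (P1) $\Pi(\sigma^{-2}\ge s)\le a_1e^{-a_2s^{a_3}}$ for large $s$. - (P2) $\Pi(\sigma^{-2}<s)\le a_4s^{a_5}$ for small $s$. - (P3) $\Pi(s<\sigma^{-2}<s(1+t))\ge a_6s^{a_7}t^{a_8}e^{-a_9s^{1/2}}$ for $s>0$, $t\in(0,1)$. - (P4) $\alpha|m\sim\mathrm{Dirichlet}(a/m,\dots,a/m)$.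 - (P5) $\Pi(m=i)\propto\exp(-a_{10}i(\log i)^{\tau_1})$ for $i\ge2$, $\tau_1\ge0$. - (P6) The $\mu_j=(\mu^y_j,\mu^x_j)$ are independent of the rest and across $j$, with $\mu^y_j$ independent of $\mu^x_j$. The density of $\mu^x_j$ is bounded away from $0$ on $\mathcal X$ and is $0$ off $\mathcal X$. The density of $\mu^y_j$ is $\ge a_{11}e^{-a_{12}\|\mu^y_j\|^{\tau_2}}$. Also $1-\Pi(\mu^y_j\in[-r,r]^{d_y})\le e^{-a_{13}r^{\tau_3}}$ for large $r$ ($\tau_2,\tau_3>0$). *)

theory Defs
  imports "HOL-Probability.Probability"
begin

definition unit_cube :: "(real^'n) set" where
  "unit_cube = {x. \<forall>i. 0 \<le> x $ i \<and> x $ i \<le> 1}"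

definition cond_densities :: "(real^'dy \<Rightarrow> real^'dx \<Rightarrow> real) set" where
  "cond_densities = {f. (\<lambda>(y, x). f y x) \<in> borel_measurable borel \<and> (\<forall>y x. 0 \<le> f y x)
      \<and> (\<forall>x\<in>unit_cube. (\<integral>\<^sup>+ y. ennreal (f y x) \<partial>lborel) = 1)}"

definition dist_h :: "(real^'dx \<Rightarrow> real) \<Rightarrow> (real^'dy \<Rightarrow> real^'dx \<Rightarrow> real)
    \<Rightarrow> (real^'dy \<Rightarrow> real^'dx \<Rightarrow> real) \<Rightarrow> real" where
  "dist_h g0 f1 f2 = sqrt (enn2real (\<integral>\<^sup>+ x. (\<integral>\<^sup>+ y.
      ennreal ((sqrt (f1 y x) - sqrt (f2 y x))\<^sup>2 * g0 x) \<partial>lborel) \<partial>lborel))"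

definition dist_1 :: "(real^'dx \<Rightarrow> real) \<Rightarrow> (real^'dy \<Rightarrow> real^'dx \<Rightarrow> real)
    \<Rightarrow> (real^'dy \<Rightarrow> real^'dx \<Rightarrow> real) \<Rightarrow> real" where
  "dist_1 g0 f1 f2 = enn2real (\<integral>\<^sup>+ x. (\<integral>\<^sup>+ y.
      ennreal (\<bar>f1 y x - f2 y x\<bar> * g0 x) \<partial>lborel) \<partial>lborel)"

text \<open>epsilon-covering number of A w.r.t. rho, balls centred in the ambient set U
  (infinity if no finite cover exists).\<close>
definition covering_number :: "real \<Rightarrow> 'f set \<Rightarrow> ('f \<Rightarrow> 'f \<Rightarrow> real) \<Rightarrow> 'f set \<Rightarrow> enat" where
  "covering_number eps A rho U =
     (INF N \<in> {N. finite N \<and> N \<subseteq> U \<and> A \<subseteq> (\<Union>c\<in>N. {f. rho f c \<le> eps})}. enat (card N))"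

definition normal_dens :: "real^'n \<Rightarrow> real \<Rightarrow> real^'n \<Rightarrow> real" where
  "normal_dens mu sg y =
     (2 * pi * sg\<^sup>2) powr (- real CARD('n) / 2) * exp (- (norm (y - mu))\<^sup>2 / (2 * sg\<^sup>2))"

definition mix_dens :: "nat \<Rightarrow> (nat \<Rightarrow> real) \<Rightarrow> (nat \<Rightarrow> real^'dy) \<Rightarrow> (nat \<Rightarrow> real^'dx) \<Rightarrow> real
    \<Rightarrow> real^'dy \<Rightarrow> real^'dx \<Rightarrow> real" where
  "mix_dens m alpha muy mux sg y x =
     (\<Sum>j<m. alpha j * exp (- (norm (x - mux j))\<^sup>2 / (2 * sg\<^sup>2))
        / (\<Sum>i<m. alpha i * exp (- (norm (x - mux i))\<^sup>2 / (2 * sg\<^sup>2)))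
        * normal_dens (muy j) sg y)"

definition valid_param :: "nat \<Rightarrow> (nat \<Rightarrow> real) \<Rightarrow> (nat \<Rightarrow> real^'dx) \<Rightarrow> real \<Rightarrow> bool" where
  "valid_param m alpha mux sg \<longleftrightarrow> 1 \<le> m \<and> 0 < sg \<and>
     (\<forall>j<m. 0 \<le> alpha j \<and> mux j \<in> unit_cube) \<and> (\<Sum>j<m. alpha j) = 1"

definition rate :: "real \<Rightarrow> real \<Rightarrow> real \<Rightarrow> nat \<Rightarrow> real" where
  "rate beta d t n = real n powr (- beta / (2 * beta + d)) * ln (real n) powr t"

definition sieve_cond :: "real \<Rightarrow> real \<Rightarrow> real \<Rightarrow> real \<Rightarrow> real \<Rightarrow> nat
    \<Rightarrow> nat \<Rightarrow> (nat \<Rightarrow> real) \<Rightarrow> (nat \<Rightarrow> real^'dy) \<Rightarrow> real \<Rightarrow> bool" where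
  "sieve_cond beta d t a3 tau3 n m alpha muy sg \<longleftrightarrow>
     (let H = real n * (rate beta d t n)\<^sup>2 / ln (real n) in
        real m \<le> H
      \<and> (\<forall>j<m. exp (- real n * H) \<le> alpha j)
      \<and> real n powr (- 1 / (2 * a3)) \<le> sg \<and> sg \<le> exp (real n)
      \<and> (\<forall>j<m. \<forall>i. \<bar>muy j $ i\<bar> \<le> real n powr (1 / tau3)))"

definition sieve :: "real \<Rightarrow> real \<Rightarrow> real \<Rightarrow> real \<Rightarrow> real \<Rightarrow> nat
    \<Rightarrow> (real^'dy \<Rightarrow> real^'dx \<Rightarrow> real) set" where
  "sieve beta d t a3 tau3 n =
     {mix_dens m alpha muy mux sg | m alpha muy mux sg.
        valid_param m alpha mux sg \<and> sieve_cond beta d t a3 tau3 n m alpha muy sg}"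

definition gamma_density :: "real \<Rightarrow> real \<Rightarrow> ennreal" where
  "gamma_density c x = (if 0 < x then ennreal (x powr (c - 1) * exp (- x) / Gamma c) else 0)"

text \<open>Dirichlet(c,...,c) on k coordinates, as the law of normalised i.i.d. Gamma(c,1) variables.\<close>
definition dirichlet :: "nat \<Rightarrow> real \<Rightarrow> (nat \<Rightarrow> real) measure" where
  "dirichlet k c = distr (PiM {..<k} (\<lambda>_. density lborel (gamma_density c)))
      (PiM {..<k} (\<lambda>_. lborel)) (\<lambda>g. \<lambda>j\<in>{..<k}. g j / (\<Sum>i<k. g i))"

datatype pidx = Rest | MuY nat | MuX nat

definition gen_events :: "'a measure \<Rightarrow> ('a \<Rightarrow> 'b) \<Rightarrow> 'b measure \<Rightarrow> 'a set set" where
  "gen_events P X N = {X -` B \<inter> space P | B. B \<in> sets N}"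

end

theory Submission
  imports Defs "HOL-Real_Asymp.Real_Asymp"
begin

text \<open>
  Entropy: if two mixtures with the same number of components have nearly equal parameters, then both
  dominate \<open>exp (- \<kappa>) * g\<close> for one and the same conditional density \<open>g\<close>, namely the first mixture with a
  slightly smaller scale in \<open>y\<close>. Hence their distance \<open>d_1\<close> is at most \<open>2 * \<kappa>\<close>, and \<open>d_h ^ 2 \<le> d_1\<close>. All the
  parameters of the sieve (the weights and the scale on a logarithmic axis) range over intervals of
  polynomial length and a mesh that is a power of \<open>1 / n\<close> suffices, so each of the at most \<open>H\<close> components
  contributes \<open>O(log n)\<close> to the entropy, in total \<open>O(H log n) = O(n \<epsilon>_n ^ 2)\<close>.

  Prior mass: by a union bound. All violations except \<open>m > H\<close> have probability exponentially small in \<open>n\<close>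
  up to polynomial factors; for the Dirichlet weights this follows from the marginal tails of the underlying
  Gamma variables. The event \<open>m > H\<close> has log-probability of order
  \<open>- H (log H) ^ \<tau>_1\<close>, which beats \<open>n \<epsilon>'_n ^ 2\<close> (with \<open>\<epsilon>'_n\<close> the rate for \<open>t_0\<close>) because \<open>2 t - 1 + \<tau>_1 > 2 t_0\<close>.
\<close>

section \<open>Mixtures with a common minorant\<close>

lemma normal_dens_pos: "sg > 0 \<Longrightarrow> normal_dens mu sg y > 0"
  by (simp add: normal_dens_def)

lemma borel_measurable_normal_dens [measurable]:
  "normal_dens mu sg \<in> borel_measurable borel"
  unfolding normal_dens_def by measurable

text \<open>The density is a product over \<open>Basis\<close> of one-dimensional normal densities,
  so its integral factors into integrals that all equal 1.\<close>

lemma nn_integral_normal_dens: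
  fixes mu :: "real^'n"
  assumes "sg > 0"
  shows "(\<integral>\<^sup>+ y. ennreal (normal_dens mu sg y) \<partial>lborel) = 1"
proof -
  have eq: "normal_dens mu sg y = (\<Prod>b\<in>Basis. normal_density (mu \<bullet> b) sg (y \<bullet> b))" for y :: "real^'n"
  proof -
    have "(\<Prod>b\<in>Basis. normal_density (mu \<bullet> b) sg (y \<bullet> b)) =
      (1 / sqrt (2 * pi * sg\<^sup>2)) ^ CARD('n) * exp (\<Sum>b\<in>Basis. - (y \<bullet> b - mu \<bullet> b)\<^sup>2 / (2 * sg\<^sup>2))"
      unfolding normal_density_def prod.distrib by (simp add: exp_sum)
    also have "(\<Sum>b\<in>Basis. - (y \<bullet> b - mu \<bullet> b)\<^sup>2 / (2 * sg\<^sup>2)) = - (norm (y - mu))\<^sup>2 / (2 * sg\<^sup>2)"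
    proof -
      have "(norm (y - mu))\<^sup>2 = (\<Sum>b\<in>Basis. (y \<bullet> b - mu \<bullet> b)\<^sup>2)"
        unfolding power2_norm_eq_inner
        by (subst euclidean_inner) (simp add: inner_diff_left power2_eq_square)
      then show ?thesis by (simp add: sum_negf flip: sum_divide_distrib)
    qed
    also have "(1 / sqrt (2 * pi * sg\<^sup>2)) ^ CARD('n) = (2 * pi * sg\<^sup>2) powr (- real CARD('n) / 2)"
    proof -
      have "1 / sqrt (2 * pi * sg\<^sup>2) = (2 * pi * sg\<^sup>2) powr (- 1 / 2)"
        using assms by (simp add: powr_minus_divide powr_half_sqrt)
      then show ?thesis using assms by (simp only:) (subst powr_power, auto)
    qed
    finally show ?thesis unfolding normal_dens_def by simp
  qed
  have "(\<integral>\<^sup>+ y. ennreal (normal_dens mu sg y) \<partial>lborel)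
      = (\<integral>\<^sup>+ y. (\<Prod>b\<in>Basis. ennreal (normal_density (mu \<bullet> b) sg (y \<bullet> b))) \<partial>lborel)"
    unfolding eq by (intro nn_integral_cong) (simp add: prod_ennreal)
  also have "\<dots> = (\<Prod>b\<in>(Basis::(real^'n) set). \<integral>\<^sup>+ x. ennreal (normal_density (mu \<bullet> b) sg x) \<partial>lborel)"
    by (intro nn_integral_lborel_prod) auto
  also have "\<dots> = 1"
    using assms by (intro prod.neutral ballI)
       (simp add: nn_integral_eq_integral integrable_normal_density integral_normal_density)
  finally show ?thesis .
qed

text \<open>Shrinking the scale from \<open>lo\<close> to \<open>lo * exp (- \<delta>)\<close>
  multiplies the quadratic form by \<open>exp (2 * \<delta>)\<close>, which leaves room for the
  shift of the mean: the cross term is split by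
  \<open>2 * u * lo \<le> u\<^sup>2 + lo\<^sup>2\<close>, and what remains costs a factor
  \<open>exp (- \<delta>)\<close>. The ratio of the scales is at most
  \<open>exp (2 * \<delta>)\<close>, which costs \<open>exp (- 2 * \<delta>)\<close> per dimension
  in the normalisation.\<close>

lemma normal_dens_minorant:
  fixes mu mu' y :: "real^'n"
  assumes "0 < \<delta>" "\<delta> \<le> 1" "0 < lo" "lo \<le> sg" "sg \<le> lo * exp \<delta>" "norm (mu - mu') \<le> \<delta> * lo"
  shows "exp (- (2 * real CARD('n) + 1) * \<delta>) * normal_dens mu (lo * exp (- \<delta>)) y \<le> normal_dens mu' sg y"
proof -
  define s where "s = lo * exp (- \<delta>)"
  define u where "u = norm (y - mu)"
  have s: "s > 0" "sg > 0" using assms by (auto simp: s_def)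
  have "norm (y - mu') \<le> u + \<delta> * lo"
    using norm_triangle_ineq[of "y - mu" "mu - mu'"] assms by (simp add: u_def)
  then have "(norm (y - mu'))\<^sup>2 \<le> (u + \<delta> * lo)\<^sup>2" by (intro power_mono) auto
  also have "\<dots> \<le> (1 + \<delta>) * u\<^sup>2 + (\<delta>\<^sup>2 + \<delta>) * lo\<^sup>2"
  proof -
    have "0 \<le> \<delta> * (u - lo)\<^sup>2" using assms by simp
    then show ?thesis by (simp add: power2_eq_square algebra_simps)
  qed
  also have "\<dots> \<le> exp (2 * \<delta>) * u\<^sup>2 + 2 * \<delta> * lo\<^sup>2"
  proof (intro add_mono mult_right_mono)
    show "1 + \<delta> \<le> exp (2 * \<delta>)" using exp_ge_add_one_self[of "2*\<delta>"] assms by linarith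
    show "\<delta>\<^sup>2 + \<delta> \<le> 2 * \<delta>" using assms by (simp add: power2_eq_square)
  qed auto
  finally have 1: "(norm (y - mu'))\<^sup>2 \<le> exp (2 * \<delta>) * u\<^sup>2 + 2 * \<delta> * lo\<^sup>2" .
  have "(norm (y - mu'))\<^sup>2 / (2 * sg\<^sup>2) \<le> (norm (y - mu'))\<^sup>2 / (2 * lo\<^sup>2)"
    using assms by (intro divide_left_mono mult_left_mono power_mono) auto
  also have "\<dots> \<le> (exp (2 * \<delta>) * u\<^sup>2 + 2 * \<delta> * lo\<^sup>2) / (2 * lo\<^sup>2)"
    by (intro divide_right_mono 1) auto
  also have "\<dots> = u\<^sup>2 / (2 * s\<^sup>2) + \<delta>"
    using assms exp_double[of \<delta>]
    by (simp add: s_def field_simps power_mult_distrib exp_minus)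
  finally have 2: "(norm (y - mu'))\<^sup>2 / (2 * sg\<^sup>2) \<le> u\<^sup>2 / (2 * s\<^sup>2) + \<delta>" .
  have "sg \<le> s * exp (2 * \<delta>)"
    using assms(5) by (simp add: s_def mult_exp_exp flip: mult.assoc) (simp add: mult.assoc mult_exp_exp)
  then have "sg\<^sup>2 \<le> (s * exp (2 * \<delta>))\<^sup>2" using s by (intro power_mono) auto
  then have 3: "2 * pi * sg\<^sup>2 \<le> (2 * pi * s\<^sup>2) * exp (4 * \<delta>)"
    by (simp add: power_mult_distrib exp_of_nat_mult[symmetric] flip: exp_of_nat2_mult) 
  have "exp (- (2 * real CARD('n)) * \<delta>) * (2 * pi * s\<^sup>2) powr (- real CARD('n) / 2)
    = ((2 * pi * s\<^sup>2) * exp (4 * \<delta>)) powr (- real CARD('n) / 2)"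
    using s by (subst powr_mult) (auto simp: powr_def ln_mult algebra_simps)
  also have "\<dots> \<le> (2 * pi * sg\<^sup>2) powr (- real CARD('n) / 2)"
    using 3 s by (intro powr_mono2') auto
  finally have 4: "exp (- (2 * real CARD('n)) * \<delta>) * (2 * pi * s\<^sup>2) powr (- real CARD('n) / 2)
    \<le> (2 * pi * sg\<^sup>2) powr (- real CARD('n) / 2)" .
  have "exp (- (2 * real CARD('n) + 1) * \<delta>) * normal_dens mu s y =
     (exp (- (2 * real CARD('n)) * \<delta>) * (2 * pi * s\<^sup>2) powr (- real CARD('n) / 2)) * exp (- (u\<^sup>2 / (2 * s\<^sup>2) + \<delta>))"
    by (simp add: normal_dens_def u_def algebra_simps exp_add exp_minus exp_diff field_simps)
  also have "\<dots> \<le> (2 * pi * sg\<^sup>2) powr (- real CARD('n) / 2) * exp (- ((norm (y - mu'))\<^sup>2 / (2 * sg\<^sup>2)))"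
    using 2 4 by (intro mult_mono) auto
  finally show ?thesis by (simp add: normal_dens_def s_def)
qed

text \<open>Subtracting the common part \<open>c * g\<close> from both densities leaves two
  nonnegative remainders of mass \<open>1 - c\<close>, and the absolute difference is at most their
  sum.\<close>

lemma nn_integral_abs_diff_minorant:
  fixes f f' g :: "'a \<Rightarrow> real"
  assumes [measurable]: "f \<in> borel_measurable M" "f' \<in> borel_measurable M" "g \<in> borel_measurable M"
    and "(\<integral>\<^sup>+ y. ennreal (f y) \<partial>M) = 1" "(\<integral>\<^sup>+ y. ennreal (f' y) \<partial>M) = 1" "(\<integral>\<^sup>+ y. ennreal (g y) \<partial>M) = 1"
    and "\<And>y. 0 \<le> g y" "0 \<le> c" "c \<le> 1"
    and le: "\<And>y. c * g y \<le> f y" "\<And>y. c * g y \<le> f' y"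
  shows "(\<integral>\<^sup>+ y. ennreal \<bar>f y - f' y\<bar> \<partial>M) \<le> ennreal (2 * (1 - c))"
proof -
  have int: "(\<integral>\<^sup>+ y. ennreal (h y - c * g y) \<partial>M) = ennreal (1 - c)"
    if [measurable]: "h \<in> borel_measurable M" and h: "(\<integral>\<^sup>+ y. ennreal (h y) \<partial>M) = 1" "\<And>y. c * g y \<le> h y" for h
  proof -
    have c: "(\<integral>\<^sup>+ y. ennreal (c * g y) \<partial>M) = ennreal c"
      using assms by (simp add: ennreal_mult nn_integral_cmult)
    have "(\<integral>\<^sup>+ y. ennreal (h y - c * g y) \<partial>M) = (\<integral>\<^sup>+ y. (ennreal (h y) - ennreal (c * g y)) \<partial>M)"
      using assms by (simp add: ennreal_minus)
    also have "\<dots> = (\<integral>\<^sup>+ y. ennreal (h y) \<partial>M) - (\<integral>\<^sup>+ y. ennreal (c * g y) \<partial>M)"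
      using h(2) c by (intro nn_integral_diff) (auto simp: ennreal_leI)
    also have "\<dots> = ennreal (1 - c)"
      using assms by (simp add: c h ennreal_minus ennreal_1[symmetric] del: ennreal_1)
    finally show ?thesis .
  qed
  have "(\<integral>\<^sup>+ y. ennreal \<bar>f y - f' y\<bar> \<partial>M) \<le> (\<integral>\<^sup>+ y. (ennreal (f y - c * g y) + ennreal (f' y - c * g y)) \<partial>M)"
  proof (intro nn_integral_mono)
    fix y
    have "\<bar>f y - f' y\<bar> \<le> (f y - c * g y) + (f' y - c * g y)" using le(1)[of y] le(2)[of y] by linarith
    then show "ennreal \<bar>f y - f' y\<bar> \<le> ennreal (f y - c * g y) + ennreal (f' y - c * g y)"
      using le(1)[of y] le(2)[of y] by (simp add: ennreal_leI flip: ennreal_plus)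
  qed
  also have "\<dots> = ennreal (1 - c) + ennreal (1 - c)"
    using assms by (simp add: nn_integral_add int)
  also have "\<dots> = ennreal (2 * (1 - c))"
    using assms by (simp flip: ennreal_plus)
  finally show ?thesis .
qed

section \<open>Kernel weights, and mixtures as conditional densities\<close>

definition kernel_weight :: "nat \<Rightarrow> (nat \<Rightarrow> real) \<Rightarrow> (nat \<Rightarrow> real^'dx) \<Rightarrow> real \<Rightarrow> real^'dx \<Rightarrow> nat \<Rightarrow> real" where
  "kernel_weight m alpha mux sg x j = alpha j * exp (- (norm (x - mux j))\<^sup>2 / (2 * sg\<^sup>2))
     / (\<Sum>i<m. alpha i * exp (- (norm (x - mux i))\<^sup>2 / (2 * sg\<^sup>2)))"

lemma mix_dens_kernel_weight:
  "mix_dens m alpha muy mux sg y x = (\<Sum>j<m. kernel_weight m alpha mux sg x j * normal_dens (muy j) sg y)"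
  by (simp add: mix_dens_def kernel_weight_def)

lemma kernel_weight_nonneg:
  assumes "valid_param m alpha mux sg" "j < m"
  shows "0 \<le> kernel_weight m alpha mux sg x j"
  using assms unfolding kernel_weight_def valid_param_def
  by (intro divide_nonneg_nonneg mult_nonneg_nonneg sum_nonneg) auto

lemma sum_kernel_weight:
  assumes "valid_param m alpha mux sg"
  shows "(\<Sum>j<m. kernel_weight m alpha mux sg x j) = 1"
proof -
  \<comment> \<open>The weights sum to 1, so one of them is nonzero and the denominator is positive;
    with denominator 0 all the quotients would be 0.\<close>
  have "\<exists>j<m. alpha j \<noteq> 0"
    using assms sum.neutral[of "{..<m}" alpha] unfolding valid_param_def by (metis lessThan_iff zero_neq_one)
  then obtain j where "j < m" "alpha j \<noteq> 0" by blast
  then have "0 < (\<Sum>i<m. alpha i * exp (- (norm (x - mux i))\<^sup>2 / (2 * sg\<^sup>2)))"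
    using assms unfolding valid_param_def by (intro sum_pos2[of _ j]) (auto simp: less_le)
  then show ?thesis
    unfolding kernel_weight_def sum_divide_distrib[symmetric] by simp
qed

lemma nn_integral_normal_mixture:
  fixes mu :: "nat \<Rightarrow> real^'n"
  assumes "\<And>j. j < m \<Longrightarrow> 0 \<le> w j" "(\<Sum>j<m. w j) = 1" "sg > 0"
  shows "(\<integral>\<^sup>+ y. ennreal (\<Sum>j<m. w j * normal_dens (mu j) sg y) \<partial>lborel) = 1"
proof -
  have "(\<integral>\<^sup>+ y. ennreal (\<Sum>j<m. w j * normal_dens (mu j) sg y) \<partial>lborel)
     = (\<integral>\<^sup>+ y. (\<Sum>j<m. ennreal (w j) * ennreal (normal_dens (mu j) sg y)) \<partial>lborel)"
    using assms by (intro nn_integral_cong, subst sum_ennreal[symmetric])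
      (auto simp: less_imp_le[OF normal_dens_pos] ennreal_mult intro!: mult_nonneg_nonneg)
  also have "\<dots> = (\<Sum>j<m. ennreal (w j))"
    using assms by (simp add: nn_integral_sum nn_integral_cmult nn_integral_normal_dens)
  also have "\<dots> = 1" using assms by (subst sum_ennreal) auto
  finally show ?thesis .
qed

text \<open>For fixed \<open>x\<close> the mixture is a convex combination of normal densities in
  \<open>y\<close>, with the normalised kernel weights as coefficients.\<close>

lemma mix_dens_in_cond_densities:
  assumes "valid_param m alpha mux sg"
  shows "mix_dens m alpha muy mux sg \<in> cond_densities"
proof -
  have sg: "sg > 0" using assms by (simp add: valid_param_def)
  have "(\<lambda>z. mix_dens m alpha muy mux sg (fst z) (snd z)) \<in> borel_measurable (borel \<Otimes>\<^sub>M borel)"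
    unfolding mix_dens_def by measurable
  then have "(\<lambda>(y, x). mix_dens m alpha muy mux sg y x) \<in> borel_measurable borel"
    by (simp add: borel_prod case_prod_beta')
  moreover have "0 \<le> mix_dens m alpha muy mux sg y x" for y x
    using assms sg unfolding mix_dens_kernel_weight
    by (intro sum_nonneg mult_nonneg_nonneg kernel_weight_nonneg) (auto simp: less_imp_le[OF normal_dens_pos])
  moreover have "(\<integral>\<^sup>+ y. ennreal (mix_dens m alpha muy mux sg y x) \<partial>lborel) = 1" for x
    using assms sg unfolding mix_dens_kernel_weight
    by (intro nn_integral_normal_mixture kernel_weight_nonneg sum_kernel_weight)
  ultimately show ?thesis by (simp add: cond_densities_def)
qed

lemma cond_densities_measurable_section:
  assumes "f \<in> cond_densities"
  shows "(\<lambda>y. f y x) \<in> borel_measurable borel"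
proof -
  have "(\<lambda>z. f (fst z) (snd z)) \<in> borel_measurable (borel \<Otimes>\<^sub>M borel)"
    using assms by (simp add: cond_densities_def borel_prod case_prod_beta')
  from measurable_compose[OF measurable_Pair2'[of x borel borel] this] show ?thesis by simp
qed

text \<open>The minorant is asked for only over the unit cube, since \<open>g0\<close> vanishes
  elsewhere; integrating the inner bound \<open>2 * (1 - c)\<close> against the density
  \<open>g0\<close> leaves it unchanged. The Hellinger bound follows from
  \<open>(sqrt u - sqrt v)\<^sup>2 \<le> \<bar>u - v\<bar>\<close>.\<close>

lemma dist_minorant:
  fixes f f' :: "real^'dy \<Rightarrow> real^'dx \<Rightarrow> real"
  assumes f: "f \<in> cond_densities" "f' \<in> cond_densities"
    and g: "\<And>x. x \<in> unit_cube \<Longrightarrow> (\<lambda>y. g y x) \<in> borel_measurable borel"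
       "\<And>x y. x \<in> unit_cube \<Longrightarrow> 0 \<le> g y x"
       "\<And>x. x \<in> unit_cube \<Longrightarrow> (\<integral>\<^sup>+ y. ennreal (g y x) \<partial>lborel) = 1"
    and c: "0 \<le> c" "c \<le> 1"
    and le: "\<And>x y. x \<in> unit_cube \<Longrightarrow> c * g y x \<le> f y x" "\<And>x y. x \<in> unit_cube \<Longrightarrow> c * g y x \<le> f' y x"
    and g0_meas: "g0 \<in> borel_measurable borel"
    and g0_nonneg: "\<And>x. 0 \<le> g0 x"
    and g0_supp: "\<And>x. x \<notin> unit_cube \<Longrightarrow> g0 x = 0"
    and g0_int: "(\<integral>\<^sup>+ x. ennreal (g0 x) \<partial>lborel) = 1"
  shows "dist_1 g0 f f' \<le> 2 * (1 - c)" "dist_h g0 f f' \<le> sqrt (2 * (1 - c))"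
proof -
  note [measurable] = cond_densities_measurable_section[OF f(1)] cond_densities_measurable_section[OF f(2)] g0_meas
  have nn: "0 \<le> f y x" "0 \<le> f' y x" for y x using f by (auto simp: cond_densities_def)
  have inner: "(\<integral>\<^sup>+ y. ennreal (\<bar>f y x - f' y x\<bar> * g0 x) \<partial>lborel) \<le> ennreal (2 * (1 - c)) * ennreal (g0 x)" for x
  proof (cases "x \<in> unit_cube")
    case True
    have "(\<integral>\<^sup>+ y. ennreal \<bar>f y x - f' y x\<bar> \<partial>lborel) \<le> ennreal (2 * (1 - c))"
      using True f g c le
      by (intro nn_integral_abs_diff_minorant[where g = "\<lambda>y. g y x"]) (auto simp: cond_densities_def)
    then show ?thesis
      by (simp add: ennreal_mult g0_nonneg nn_integral_multc mult_right_mono)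
  qed (simp add: g0_supp)
  have "(\<integral>\<^sup>+ x. (\<integral>\<^sup>+ y. ennreal (\<bar>f y x - f' y x\<bar> * g0 x) \<partial>lborel) \<partial>lborel)
      \<le> (\<integral>\<^sup>+ x. ennreal (2 * (1 - c)) * ennreal (g0 x) \<partial>lborel)"
    by (intro nn_integral_mono inner)
  also have "\<dots> = ennreal (2 * (1 - c))"
    by (simp add: nn_integral_cmult g0_int)
  finally have 1: "(\<integral>\<^sup>+ x. (\<integral>\<^sup>+ y. ennreal (\<bar>f y x - f' y x\<bar> * g0 x) \<partial>lborel) \<partial>lborel) \<le> ennreal (2 * (1 - c))" .
  then show "dist_1 g0 f f' \<le> 2 * (1 - c)"
    unfolding dist_1_def using c enn2real_leI by auto
  have "(sqrt u - sqrt v)\<^sup>2 \<le> \<bar>u - v\<bar>" if "0 \<le> u" "0 \<le> v" for u v :: real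
  proof -
    have "(sqrt u - sqrt v)\<^sup>2 = \<bar>sqrt u - sqrt v\<bar> * \<bar>sqrt u - sqrt v\<bar>" by (simp add: power2_eq_square)
    also have "\<dots> \<le> \<bar>sqrt u - sqrt v\<bar> * \<bar>sqrt u + sqrt v\<bar>"
      using that real_sqrt_ge_zero[of u] real_sqrt_ge_zero[of v] by (intro mult_left_mono) linarith+
    also have "\<dots> = \<bar>u - v\<bar>" using that
      by (simp only: abs_mult[symmetric]) (simp add: algebra_simps)
    finally show ?thesis .
  qed
  then have "(\<integral>\<^sup>+ x. (\<integral>\<^sup>+ y. ennreal ((sqrt (f y x) - sqrt (f' y x))\<^sup>2 * g0 x) \<partial>lborel) \<partial>lborel)
     \<le> (\<integral>\<^sup>+ x. (\<integral>\<^sup>+ y. ennreal (\<bar>f y x - f' y x\<bar> * g0 x) \<partial>lborel) \<partial>lborel)"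
    by (intro nn_integral_mono ennreal_leI mult_right_mono g0_nonneg) (auto simp: nn)
  also note 1
  finally show "dist_h g0 f f' \<le> sqrt (2 * (1 - c))"
    unfolding dist_h_def using c enn2real_leI by auto
qed

text \<open>A logarithmic perturbation of size \<open>\<eta>\<close> can lower the numerator by the
  factor \<open>exp (- \<eta>)\<close> and raise the denominator by the factor
  \<open>exp \<eta>\<close>; hence the exponent \<open>2 * \<eta>\<close>.\<close>

lemma normalised_weight_lower:
  fixes u v :: "nat \<Rightarrow> real"
  assumes "\<And>j. j < m \<Longrightarrow> 0 < u j" "\<And>j. j < m \<Longrightarrow> 0 < v j" "\<And>j. j < m \<Longrightarrow> \<bar>ln (u j) - ln (v j)\<bar> \<le> \<eta>" "j < m"
  shows "exp (- 2 * \<eta>) * (u j / (\<Sum>i<m. u i)) \<le> v j / (\<Sum>i<m. v i)"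
proof -
  have up: "v i \<le> exp \<eta> * u i" if "i < m" for i
  proof -
    have "v i = exp (ln (v i))" using assms that by simp
    also have "\<dots> \<le> exp (\<eta> + ln (u i))" using assms(3)[OF that] by simp
    also have "\<dots> = exp \<eta> * u i" using assms that by (simp add: exp_add)
    finally show ?thesis .
  qed
  have lo: "exp (- \<eta>) * u j \<le> v j"
  proof -
    have "exp (- \<eta>) * u j = exp (- \<eta> + ln (u j))" using assms(1)[OF assms(4)] unfolding exp_add by simp
    also have "\<dots> \<le> exp (ln (v j))" using assms(3)[OF assms(4)] by simp
    finally show ?thesis using assms by simp
  qed
  have sp: "0 < (\<Sum>i<m. u i)" "0 < (\<Sum>i<m. v i)" using assms by (auto intro!: sum_pos)
  have "(\<Sum>i<m. v i) \<le> exp \<eta> * (\<Sum>i<m. u i)"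
    using up by (auto simp: sum_distrib_left intro!: sum_mono)
  then have "(exp (- \<eta>) * u j) / (exp \<eta> * (\<Sum>i<m. u i)) \<le> v j / (\<Sum>i<m. v i)"
    using lo sp assms by (intro frac_le) (auto intro: less_imp_le)
  moreover have "exp (- 2 * \<eta>) = exp (- \<eta>) / exp \<eta>" by (simp add: exp_diff[symmetric])
  ultimately show ?thesis by simp
qed

text \<open>The difference of the two quotients is split into a change of the squared distance at
  fixed precision and a change of the precision at fixed squared distance. In the unit cube each
  coordinate adds at most \<open>2 * \<delta>\<close> to the first change, and the squared distance
  is at most the dimension; each part contributes \<open>CARD('n) * \<delta> * V\<close>.\<close>

lemma kernel_exponent_lipschitz:
  fixes x mu mu' :: "real^'n"
  assumes "x \<in> unit_cube" "mu \<in> unit_cube" "mu' \<in> unit_cube" "\<And>i. \<bar>mu $ i - mu' $ i\<bar> \<le> \<delta>"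
    "0 < sg" "0 < sg'" "1 / sg\<^sup>2 \<le> V" "1 / sg'\<^sup>2 \<le> V" "\<bar>ln sg - ln sg'\<bar> \<le> \<delta>"
  shows "\<bar>(norm (x - mu))\<^sup>2 / (2 * sg\<^sup>2) - (norm (x - mu'))\<^sup>2 / (2 * sg'\<^sup>2)\<bar> \<le> 2 * real CARD('n) * \<delta> * V"
proof -
  have \<delta>: "0 \<le> \<delta>" using assms(9) by linarith
  have sq: "(norm z)\<^sup>2 = (\<Sum>i\<in>UNIV. (z $ i)\<^sup>2)" for z :: "real^'n"
    by (simp add: norm_vec_def L2_set_def sum_nonneg)
  have "\<bar>(norm (x - mu))\<^sup>2 - (norm (x - mu'))\<^sup>2\<bar> = \<bar>\<Sum>i\<in>UNIV. (mu' $ i - mu $ i) * (2 * x $ i - mu $ i - mu' $ i)\<bar>"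
    unfolding sq sum_subtractf[symmetric] by (simp add: power2_eq_square algebra_simps)
  also have "\<dots> \<le> (\<Sum>i\<in>(UNIV::'n set). \<delta> * 2)"
  proof (intro order_trans[OF sum_abs] sum_mono)
    fix i
    have "\<bar>mu' $ i - mu $ i\<bar> \<le> \<delta>" using assms(4)[of i] by linarith
    moreover have "\<bar>2 * x $ i - mu $ i - mu' $ i\<bar> \<le> 2"
      using assms(1-3)[unfolded unit_cube_def mem_Collect_eq, THEN spec, of i] by linarith
    ultimately show "\<bar>(mu' $ i - mu $ i) * (2 * x $ i - mu $ i - mu' $ i)\<bar> \<le> \<delta> * 2"
      unfolding abs_mult by (intro mult_mono) (use \<delta> in auto)
  qed
  finally have 1: "\<bar>(norm (x - mu))\<^sup>2 - (norm (x - mu'))\<^sup>2\<bar> \<le> 2 * real CARD('n) * \<delta>" by simp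
  have "(norm (x - mu'))\<^sup>2 \<le> (\<Sum>i\<in>(UNIV::'n set). 1)"
    unfolding sq
  proof (intro sum_mono)
    fix i
    have "\<bar>x $ i - mu' $ i\<bar> \<le> 1"
      using assms(1,3)[unfolded unit_cube_def mem_Collect_eq, THEN spec, of i] by linarith
    then show "((x - mu') $ i)\<^sup>2 \<le> 1" by (simp add: abs_square_le_1)
  qed
  then have 2: "(norm (x - mu'))\<^sup>2 \<le> real CARD('n)" by simp
  have inv: "1 / s\<^sup>2 = exp (- 2 * ln s)" if "0 < s" for s :: real
    using that by (simp add: exp_minus exp_double inverse_eq_divide)
  \<comment> \<open>The inequality \<open>exp z \<ge> 1 + z\<close> gives a one-sided estimate; used
    with \<open>s\<close> and \<open>s'\<close> interchanged as well, it bounds the absolute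
    value.\<close>
  have diff: "1 / s\<^sup>2 - 1 / s'\<^sup>2 \<le> 2 * \<delta> * V"
    if s: "0 < s" "0 < s'" "1 / s\<^sup>2 \<le> V" "\<bar>ln s - ln s'\<bar> \<le> \<delta>" for s s' :: real
  proof -
    have "1 / s'\<^sup>2 = 1 / s\<^sup>2 * exp (2 * (ln s - ln s'))"
      using s by (simp add: inv flip: exp_add)
    also have "\<dots> \<ge> 1 / s\<^sup>2 * (1 + 2 * (ln s - ln s'))"
      by (intro mult_left_mono exp_ge_add_one_self) auto
    finally have "1 / s\<^sup>2 - 1 / s'\<^sup>2 \<le> 1 / s\<^sup>2 * (2 * (ln s' - ln s))" by (simp add: algebra_simps)
    also have "\<dots> \<le> 1 / s\<^sup>2 * (2 * \<delta>)" using s by (intro mult_left_mono) auto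
    also have "\<dots> \<le> V * (2 * \<delta>)" using s \<delta> by (intro mult_right_mono) auto
    finally show ?thesis by (simp add: algebra_simps)
  qed
  have 3: "\<bar>1 / sg\<^sup>2 - 1 / sg'\<^sup>2\<bar> \<le> 2 * \<delta> * V"
    using diff[of sg sg'] diff[of sg' sg] assms by (auto simp: abs_le_iff abs_minus_commute)
  have "(norm (x - mu))\<^sup>2 / (2 * sg\<^sup>2) - (norm (x - mu'))\<^sup>2 / (2 * sg'\<^sup>2)
    = ((norm (x - mu))\<^sup>2 - (norm (x - mu'))\<^sup>2) * (1 / sg\<^sup>2) / 2 + (norm (x - mu'))\<^sup>2 * (1 / sg\<^sup>2 - 1 / sg'\<^sup>2) / 2"
    by (simp add: algebra_simps diff_divide_distrib)
  also have "\<bar>\<dots>\<bar> \<le> \<bar>(norm (x - mu))\<^sup>2 - (norm (x - mu'))\<^sup>2\<bar> * (1 / sg\<^sup>2) / 2 + (norm (x - mu'))\<^sup>2 * \<bar>1 / sg\<^sup>2 - 1 / sg'\<^sup>2\<bar> / 2"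
    by (rule order_trans[OF abs_triangle_ineq]) (simp add: abs_mult)
  also have "\<dots> \<le> (2 * real CARD('n) * \<delta>) * V / 2 + real CARD('n) * (2 * \<delta> * V) / 2"
    using 1 2 3 assms(7) \<delta> by (intro add_mono divide_right_mono mult_mono) auto
  finally show ?thesis by (simp add: mult_ac)
qed

text \<open>The minorant \<open>g\<close> keeps the weights and means of the first mixture and takes
  a scale just below both scales. In \<open>C\<close>, the first summand is the price of the
  weights, twice the log perturbation of an unnormalised weight; the second is the price of the
  normal densities, where the last factor \<open>CARD('dy)\<close> passes from coordinatewise
  closeness to the norm.\<close>

lemma mix_dens_dist_le:
  fixes muy muy' :: "nat \<Rightarrow> real^'dy" and mux mux' :: "nat \<Rightarrow> real^'dx"
  defines "C \<equiv> 2 * (1 + 2 * real CARD('dx)) + (2 * real CARD('dy) + 1) * real CARD('dy)"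
  assumes valid: "valid_param m alpha mux sg" "valid_param m alpha' mux' sg'"
    and pos: "\<And>j. j < m \<Longrightarrow> 0 < alpha j" "\<And>j. j < m \<Longrightarrow> 0 < alpha' j"
    and V: "1 \<le> V" "1 / sg\<^sup>2 \<le> V" "1 / sg'\<^sup>2 \<le> V"
    and \<delta>: "0 < \<delta>" "C * \<delta> * V \<le> 1"
    and close: "\<And>j. j < m \<Longrightarrow> \<bar>ln (alpha j) - ln (alpha' j)\<bar> \<le> \<delta>" "\<bar>ln sg - ln sg'\<bar> \<le> \<delta>"
      "\<And>j i. j < m \<Longrightarrow> \<bar>muy j $ i - muy' j $ i\<bar> \<le> \<delta>"
      "\<And>j i. j < m \<Longrightarrow> \<bar>mux j $ i - mux' j $ i\<bar> \<le> \<delta>"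
    and g0_meas: "g0 \<in> borel_measurable borel"
    and g0_nonneg: "\<And>x. 0 \<le> g0 x"
    and g0_supp: "\<And>x. x \<notin> unit_cube \<Longrightarrow> g0 x = 0"
    and g0_int: "(\<integral>\<^sup>+ x. ennreal (g0 x) \<partial>lborel) = 1"
  shows "dist_1 g0 (mix_dens m alpha muy mux sg) (mix_dens m alpha' muy' mux' sg') \<le> 2 * C * \<delta> * V"
    and "dist_h g0 (mix_dens m alpha muy mux sg) (mix_dens m alpha' muy' mux' sg') \<le> sqrt (2 * C * \<delta> * V)"
proof -
  define D where "D = real CARD('dx)"
  define E where "E = real CARD('dy)"
  have DE: "1 \<le> D" "1 \<le> E" by (simp_all add: D_def E_def Suc_le_eq)
  \<comment> \<open>\<open>\<eta>\<close> bounds the change of the log of an unnormalised weight: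
    \<open>\<delta>\<close> from \<open>alpha\<close> and \<open>2 * D * \<delta> * V\<close> from
    the exponent. \<open>\<delta>'\<close> measures the closeness of the means relative to
    \<open>lo\<close>: they differ by at most \<open>E * \<delta>\<close> in norm, and
    \<open>1 \<le> V * lo\<close>.\<close>
  define \<eta> where "\<eta> = (1 + 2 * D) * \<delta> * V"
  define \<delta>' where "\<delta>' = E * \<delta> * V"
  define lo where "lo = min sg sg'"
  define \<kappa> where "\<kappa> = 2 * \<eta> + (2 * E + 1) * \<delta>'"
  have \<kappa>: "\<kappa> = C * \<delta> * V" by (simp add: \<kappa>_def C_def \<eta>_def \<delta>'_def D_def E_def algebra_simps)
  have sg: "0 < sg" "0 < sg'" using valid by (auto simp: valid_param_def)
  then have lo: "0 < lo" "lo \<le> sg" "lo \<le> sg'" by (auto simp: lo_def)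
  have \<eta>0: "0 \<le> \<eta>" using DE V \<delta> by (simp add: \<eta>_def)
  have \<delta>V: "\<delta> \<le> \<delta> * V" using V \<delta> by simp
  have "\<delta> * V \<le> \<delta>'" using DE V \<delta> unfolding \<delta>'_def by (simp add: mult.assoc)
  then have \<delta>'0: "\<delta> \<le> \<delta>'" "0 < \<delta>'" using \<delta>V \<delta>(1) by linarith+
  have "\<delta>' \<le> (2 * E + 1) * \<delta>'" using DE \<delta>'0 by simp
  then have \<delta>'1: "\<delta>' \<le> 1" using \<delta> \<eta>0 \<kappa> unfolding \<kappa>_def by linarith
  have \<kappa>0: "0 \<le> \<kappa>" unfolding \<kappa>_def using \<eta>0 \<delta>'0 DE by simp
  have up: "s \<le> lo * exp \<delta>'" if "s \<in> {sg, sg'}" for s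
  proof -
    have "ln s \<le> ln lo + \<delta>'" using that close(2) \<delta>'0 unfolding lo_def min_def by (auto split: if_splits)
    then have "exp (ln s) \<le> exp (ln lo + \<delta>')" by simp
    then show ?thesis using that sg lo by (auto simp: exp_add)
  qed
  \<comment> \<open>Both precisions are at most \<open>V\<close>, so
    \<open>1 \<le> V * lo\<^sup>2\<close>; a further factor \<open>V \<ge> 1\<close> completes the
    square \<open>(V * lo)\<^sup>2\<close>.\<close>
  have Vlo: "1 \<le> V * lo"
  proof -
    have "1 \<le> V * lo\<^sup>2" using V sg by (auto simp: lo_def min_def field_simps)
    also have "\<dots> \<le> V * (V * lo\<^sup>2)" using V mult_right_mono[of 1 V "V * lo\<^sup>2"] by simp
    also have "\<dots> = (V * lo)\<^sup>2" by (simp add: power2_eq_square)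
    finally show ?thesis using V lo power2_le_imp_le[of 1 "V * lo"] by simp
  qed
  have muy: "norm (muy j - muy' j) \<le> \<delta>' * lo" if "j < m" for j
  proof -
    have "norm (muy j - muy' j) \<le> (\<Sum>i\<in>UNIV. \<bar>(muy j - muy' j) $ i\<bar>)" by (rule norm_le_l1_cart)
    also have "\<dots> \<le> (\<Sum>i\<in>(UNIV::'dy set). \<delta>)" using close(3)[OF that] by (intro sum_mono) simp
    also have "\<dots> = E * \<delta> * 1" by (simp add: E_def)
    also have "\<dots> \<le> E * \<delta> * (V * lo)" using Vlo \<delta> DE by (intro mult_left_mono) auto
    finally show ?thesis by (simp add: \<delta>'_def mult_ac)
  qed
  define g where "g = (\<lambda>y x. \<Sum>j<m. kernel_weight m alpha mux sg x j * normal_dens (muy j) (lo * exp (- \<delta>')) y)"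
  have g: "(\<lambda>y. g y x) \<in> borel_measurable borel" "0 \<le> g y x" "(\<integral>\<^sup>+ y. ennreal (g y x) \<partial>lborel) = 1" for x y
    using lo valid unfolding g_def
    by (auto intro!: sum_nonneg mult_nonneg_nonneg kernel_weight_nonneg less_imp_le[OF normal_dens_pos]
        nn_integral_normal_mixture sum_kernel_weight)
  have weight: "exp (- 2 * \<eta>) * kernel_weight m alpha mux sg x j \<le> kernel_weight m alpha' mux' sg' x j"
    if x: "x \<in> unit_cube" and "j < m" for x j
    unfolding kernel_weight_def
  proof (rule normalised_weight_lower[OF _ _ _ \<open>j < m\<close>])
    fix i assume i: "i < m"
    have "\<bar>(norm (x - mux i))\<^sup>2 / (2 * sg\<^sup>2) - (norm (x - mux' i))\<^sup>2 / (2 * sg'\<^sup>2)\<bar> \<le> 2 * D * \<delta> * V"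
      unfolding D_def using x i valid close V sg
      by (intro kernel_exponent_lipschitz) (auto simp: valid_param_def)
    then have "\<bar>ln (alpha i) - (norm (x - mux i))\<^sup>2 / (2 * sg\<^sup>2) - (ln (alpha' i) - (norm (x - mux' i))\<^sup>2 / (2 * sg'\<^sup>2))\<bar>
        \<le> \<delta> * V + 2 * D * \<delta> * V"
      using close(1)[OF i] \<delta>V by linarith
    then show "\<bar>ln (alpha i * exp (- (norm (x - mux i))\<^sup>2 / (2 * sg\<^sup>2))) - ln (alpha' i * exp (- (norm (x - mux' i))\<^sup>2 / (2 * sg'\<^sup>2)))\<bar> \<le> \<eta>"
      using pos[OF i] by (simp add: ln_mult \<eta>_def algebra_simps)
  qed (use pos in auto)
  \<comment> \<open>The first mixture and \<open>g\<close> share weights and means, so only the loss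
    of the normal densities occurs and the part \<open>2 * \<eta>\<close> of \<open>\<kappa>\<close>
    is given away.\<close>
  have le1: "exp (- \<kappa>) * g y x \<le> mix_dens m alpha muy mux sg y x" for x y
    unfolding g_def mix_dens_kernel_weight sum_distrib_left
  proof (intro sum_mono)
    fix j assume "j \<in> {..<m}"
    then have j: "j < m" by simp
    have w: "0 \<le> kernel_weight m alpha mux sg x j" using kernel_weight_nonneg[OF valid(1) j] .
    have "exp (- \<kappa>) * normal_dens (muy j) (lo * exp (- \<delta>')) y
       \<le> exp (- (2 * E + 1) * \<delta>') * normal_dens (muy j) (lo * exp (- \<delta>')) y"
      using \<eta>0 lo by (intro mult_right_mono less_imp_le[OF normal_dens_pos]) (auto simp: \<kappa>_def algebra_simps)
    also have "\<dots> \<le> normal_dens (muy j) sg y"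
      unfolding E_def using \<delta>'0 \<delta>'1 lo up by (intro normal_dens_minorant) auto
    finally show "exp (- \<kappa>) * (kernel_weight m alpha mux sg x j * normal_dens (muy j) (lo * exp (- \<delta>')) y)
       \<le> kernel_weight m alpha mux sg x j * normal_dens (muy j) sg y"
      unfolding mult.left_commute[of "exp (- \<kappa>)"] by (rule mult_left_mono[OF _ w])
  qed
  \<comment> \<open>For the second mixture both losses occur, and they multiply to exactly
    \<open>exp (- \<kappa>)\<close>.\<close>
  have le2: "exp (- \<kappa>) * g y x \<le> mix_dens m alpha' muy' mux' sg' y x" if x: "x \<in> unit_cube" for x y
    unfolding g_def mix_dens_kernel_weight sum_distrib_left
  proof (intro sum_mono)
    fix j assume "j \<in> {..<m}"
    then have j: "j < m" by simp
    have "exp (- \<kappa>) * (kernel_weight m alpha mux sg x j * normal_dens (muy j) (lo * exp (- \<delta>')) y)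
       = (exp (- 2 * \<eta>) * kernel_weight m alpha mux sg x j)
         * (exp (- (2 * E + 1) * \<delta>') * normal_dens (muy j) (lo * exp (- \<delta>')) y)"
    proof -
      have "- \<kappa> = - 2 * \<eta> + - (2 * E + 1) * \<delta>'" by (simp add: \<kappa>_def algebra_simps)
      then show ?thesis by (simp only: exp_add mult_ac)
    qed
    also have "\<dots> \<le> kernel_weight m alpha' mux' sg' x j * normal_dens (muy' j) sg' y"
    proof (intro mult_mono weight x j)
      show "exp (- (2 * E + 1) * \<delta>') * normal_dens (muy j) (lo * exp (- \<delta>')) y \<le> normal_dens (muy' j) sg' y"
        unfolding E_def using \<delta>'0 \<delta>'1 lo up muy[OF j] by (intro normal_dens_minorant) auto
      show "0 \<le> kernel_weight m alpha' mux' sg' x j" using kernel_weight_nonneg[OF valid(2) j] .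
      show "0 \<le> exp (- (2 * E + 1) * \<delta>') * normal_dens (muy j) (lo * exp (- \<delta>')) y"
        using lo by (intro mult_nonneg_nonneg less_imp_le[OF normal_dens_pos]) auto
    qed
    finally show "exp (- \<kappa>) * (kernel_weight m alpha mux sg x j * normal_dens (muy j) (lo * exp (- \<delta>')) y)
       \<le> kernel_weight m alpha' mux' sg' x j * normal_dens (muy' j) sg' y" .
  qed
  have "1 - exp (- \<kappa>) \<le> \<kappa>" using exp_ge_add_one_self[of "- \<kappa>"] by linarith
  then have fin: "2 * (1 - exp (- \<kappa>)) \<le> 2 * C * \<delta> * V" by (simp add: \<kappa>)
  have c: "0 \<le> exp (- \<kappa>)" "exp (- \<kappa>) \<le> 1" using \<kappa>0 by auto
  note dens = mix_dens_in_cond_densities[OF valid(1)] mix_dens_in_cond_densities[OF valid(2)]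
  have "dist_1 g0 (mix_dens m alpha muy mux sg) (mix_dens m alpha' muy' mux' sg') \<le> 2 * (1 - exp (- \<kappa>))"
    by (rule dist_minorant(1)[where g = g]) (rule dens g c le1 le2 g0_meas g0_nonneg g0_supp g0_int | assumption)+
  then show "dist_1 g0 (mix_dens m alpha muy mux sg) (mix_dens m alpha' muy' mux' sg') \<le> 2 * C * \<delta> * V"
    using fin by (rule order_trans)
  have "dist_h g0 (mix_dens m alpha muy mux sg) (mix_dens m alpha' muy' mux' sg') \<le> sqrt (2 * (1 - exp (- \<kappa>)))"
    by (rule dist_minorant(2)[where g = g]) (rule dens g c le1 le2 g0_meas g0_nonneg g0_supp g0_int | assumption)+
  then show "dist_h g0 (mix_dens m alpha muy mux sg) (mix_dens m alpha' muy' mux' sg') \<le> sqrt (2 * C * \<delta> * V)"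
    using real_sqrt_le_mono[OF fin] by (rule order_trans)
qed

section \<open>Covering numbers\<close>

text \<open>Choosing one representative in \<open>P\<close> per occupied cell avoids constructing grid points.\<close>

lemma covering_number_le_keys:
  assumes fin: "finite Keys" and sub: "f ` P \<subseteq> U"
    and key: "\<And>p. p \<in> P \<Longrightarrow> key p \<in> Keys"
    and close: "\<And>p q. p \<in> P \<Longrightarrow> q \<in> P \<Longrightarrow> key p = key q \<Longrightarrow> rho (f p) (f q) \<le> eps"
  shows "covering_number eps (f ` P) rho U \<le> enat (card Keys)"
proof -
  define r where "r k = (SOME p. p \<in> P \<and> key p = k)" for k
  have r: "r (key p) \<in> P \<and> key (r (key p)) = key p" if "p \<in> P" for p
  proof -
    have "\<exists>q. q \<in> P \<and> key q = key p" using that by blast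
    then show ?thesis unfolding r_def by (rule someI_ex)
  qed
  define N where "N = (\<lambda>k. f (r k)) ` (key ` P)"
  have finP: "finite (key ` P)" using fin key by (meson finite_subset image_subsetI)
  have "finite N" "N \<subseteq> U" using finP r sub by (auto simp: N_def)
  moreover have "f ` P \<subseteq> (\<Union>c\<in>N. {g. rho g c \<le> eps})"
  proof
    fix g assume "g \<in> f ` P"
    then obtain p where p: "p \<in> P" "g = f p" by auto
    then have "rho g (f (r (key p))) \<le> eps" using r[OF p(1)] close[OF p(1)] by auto
    moreover have "f (r (key p)) \<in> N" using p by (auto simp: N_def)
    ultimately show "g \<in> (\<Union>c\<in>N. {g. rho g c \<le> eps})" by auto
  qed
  ultimately have "covering_number eps (f ` P) rho U \<le> enat (card N)"
    unfolding covering_number_def by (intro INF_lower) auto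
  also have "card N \<le> card Keys"
    using card_image_le[OF finP, of "\<lambda>k. f (r k)"] card_mono[OF fin, of "key ` P"] key
    unfolding N_def by (meson image_subsetI le_trans)
  finally show ?thesis by simp
qed

lemma abs_diff_le_floor_eq:
  assumes "\<lfloor>u / \<delta>\<rfloor> = \<lfloor>v / \<delta>\<rfloor>" "0 < (\<delta>::real)"
  shows "\<bar>u - v\<bar> \<le> \<delta>"
proof -
  have "\<bar>u / \<delta> - v / \<delta>\<bar> < 1" using assms(1) by linarith
  then have "\<bar>u - v\<bar> / \<delta> < 1" using assms(2) by (simp add: diff_divide_distrib[symmetric])
  then show ?thesis using assms(2) by (simp add: field_simps)
qed

lemma floor_quotient_bounds:
  assumes "\<bar>u\<bar> \<le> \<delta> * real K" "0 < (\<delta>::real)"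
  shows "\<lfloor>u / \<delta>\<rfloor> \<in> {- int K..int K}"
proof -
  have "u / \<delta> \<le> real K" "- real K \<le> u / \<delta>"
    using assms by (auto simp: pos_divide_le_eq pos_le_divide_eq mult.commute abs_le_iff)
  then show ?thesis by (simp add: le_floor_iff floor_le_iff)
qed

text \<open>The parameters form a vector of \<open>1 + m * (1 + CARD('dy) + CARD('dx))\<close>
  coordinates bounded by \<open>\<delta> * K\<close>, with the scale and the weights on a
  logarithmic axis. A cell of mesh \<open>\<delta>\<close> is named by the floors of the coordinates
  divided by \<open>\<delta>\<close>, each with \<open>2 * K + 1\<close> possible values, and two
  parameters in one cell have close mixtures. \<open>Q\<close> stands for the conditions of the
  sieve, so that the bound is free of \<open>n\<close>.\<close>

lemma covering_number_mix_dens_le: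
  fixes Q :: "nat \<Rightarrow> (nat \<Rightarrow> real) \<Rightarrow> (nat \<Rightarrow> real^'dy) \<Rightarrow> (nat \<Rightarrow> real^'dx) \<Rightarrow> real \<Rightarrow> bool"
  defines "C \<equiv> 2 * (1 + 2 * real CARD('dx)) + (2 * real CARD('dy) + 1) * real CARD('dy)"
  assumes Q: "\<And>m alpha muy mux sg. Q m alpha muy mux sg \<Longrightarrow> valid_param m alpha mux sg \<and> m \<le> h \<and> 1 / sg\<^sup>2 \<le> V
      \<and> \<bar>ln sg\<bar> \<le> \<delta> * real K \<and> (\<forall>j<m. exp (- (\<delta> * real K)) \<le> alpha j) \<and> (\<forall>j<m. \<forall>i. \<bar>muy j $ i\<bar> \<le> \<delta> * real K)"
    and \<delta>: "0 < \<delta>" "1 \<le> \<delta> * real K" "2 * C * \<delta> * V \<le> eps\<^sup>2" and eps: "0 < eps" "eps \<le> 1" and V: "1 \<le> V"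
    and g0_meas: "g0 \<in> borel_measurable borel"
    and g0_nonneg: "\<And>x. 0 \<le> g0 x"
    and g0_supp: "\<And>x. x \<notin> unit_cube \<Longrightarrow> g0 x = 0"
    and g0_int: "(\<integral>\<^sup>+ x. ennreal (g0 x) \<partial>lborel) = 1"
    and rho: "rho \<in> {dist_h g0, dist_1 g0}"
  shows "covering_number eps {mix_dens m alpha muy mux sg | m alpha muy mux sg. Q m alpha muy mux sg} rho cond_densities
     \<le> enat ((h + 1) * (2 * K + 1) ^ (1 + h * (1 + CARD('dy) + CARD('dx))))"
proof -
  \<comment> \<open>\<open>None\<close> indexes the log scale; \<open>Some (j, c)\<close> indexes
    the data of component \<open>j\<close>, with \<open>c\<close> choosing a coordinate of
    \<open>muy j\<close>, a coordinate of \<open>mux j\<close>, or the log weight.\<close>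
  define I where "I m = insert None (Some ` ({..<m} \<times> (UNIV :: ('dy + 'dx + unit) set)))" for m :: nat
  define coord where "coord = (\<lambda>(alpha :: nat \<Rightarrow> real) (muy :: nat \<Rightarrow> real^'dy) (mux :: nat \<Rightarrow> real^'dx) sg k.
    case k of None \<Rightarrow> ln sg | Some (j, c) \<Rightarrow>
      (case c of Inl i \<Rightarrow> muy j $ i | Inr c \<Rightarrow> (case c of Inl i \<Rightarrow> mux j $ i | Inr (_::unit) \<Rightarrow> ln (alpha j))))"
  \<comment> \<open>The restriction to \<open>I m\<close> forgets the values \<open>alpha j\<close>,
    \<open>muy j\<close>, \<open>mux j\<close> with \<open>j \<ge> m\<close>, so that finitely many
    integers name a cell.\<close>
  define key where "key = (\<lambda>(m, alpha, muy, mux, sg). (m, \<lambda>k\<in>I m. \<lfloor>coord alpha muy mux sg k / \<delta>\<rfloor>))"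
  define P where "P = {(m, alpha, muy, mux, sg). Q m alpha muy mux sg}"
  define f where "f = (\<lambda>(m, alpha, muy, mux, sg). mix_dens m alpha muy mux sg :: real^'dy \<Rightarrow> real^'dx \<Rightarrow> real)"
  define Keys where "Keys = Sigma {..h} (\<lambda>m. PiE (I m) (\<lambda>_. {- int K..int K}))"
  have I: "finite (I m)" "card (I m) = 1 + m * (1 + CARD('dy) + CARD('dx))" for m
    by (auto simp: I_def card_image card_cartesian_product card_Plus UNIV_Plus_UNIV[symmetric] simp del: UNIV_Plus_UNIV)
  have eq: "{mix_dens m alpha muy mux sg | m alpha muy mux sg. Q m alpha muy mux sg} = f ` P"
    by (force simp: f_def P_def)
  have "covering_number eps (f ` P) rho cond_densities \<le> enat (card Keys)"
  proof (rule covering_number_le_keys[where key = key])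
    show "finite Keys" unfolding Keys_def by (intro finite_SigmaI finite_PiE I) auto
    show "f ` P \<subseteq> cond_densities"
      using Q by (auto simp: f_def P_def intro!: mix_dens_in_cond_densities)
  next
    fix p assume "p \<in> P"
    then obtain m alpha muy mux sg where p: "p = (m, alpha, muy, mux, sg)" "Q m alpha muy mux sg"
      by (auto simp: P_def)
    note q = Q[OF p(2)]
    have "\<bar>coord alpha muy mux sg k\<bar> \<le> \<delta> * real K" if k: "k \<in> I m" for k
    proof (cases k)
      case None
      then show ?thesis using q by (simp add: coord_def)
    next
      case (Some jc)
      then obtain j c where jc: "k = Some (j, c)" "j < m" using k by (auto simp: I_def)
      show ?thesis
      proof (cases c)
        case (Inl i)
        then show ?thesis using q jc by (simp add: coord_def)
      next
        case (Inr c')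
        show ?thesis
        proof (cases c')
          case (Inl i)
          have "mux j \<in> unit_cube" using q jc by (auto simp: valid_param_def)
          then have "0 \<le> mux j $ i" "mux j $ i \<le> 1" by (auto simp: unit_cube_def)
          then show ?thesis using jc Inr Inl \<delta>(2) by (simp add: coord_def)
        next
          case (Inr u)
          have a: "exp (- (\<delta> * real K)) \<le> alpha j" using q jc by auto
          \<comment> \<open>A single weight is at most the sum 1, so \<open>ln (alpha j)\<close> is
            nonpositive and only the lower cutoff limits its range.\<close>
          moreover have "alpha j \<le> 1"
            using q jc member_le_sum[of j "{..<m}" alpha] by (auto simp: valid_param_def)
          moreover have "0 < alpha j" using a exp_gt_zero[of "- (\<delta> * real K)"] by linarith
          ultimately have "ln (alpha j) \<le> 0" "- (\<delta> * real K) \<le> ln (alpha j)"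
            by (auto simp: ln_ge_iff)
          then show ?thesis using jc \<open>c = Inr c'\<close> Inr by (simp add: coord_def)
        qed
      qed
    qed
    then show "key p \<in> Keys" using q \<delta>(1) by (auto simp: p key_def Keys_def intro!: floor_quotient_bounds simp del: atLeastAtMost_iff)
  next
    fix p p' assume "p \<in> P" "p' \<in> P" and "key p = key p'"
    then obtain m alpha muy mux sg m' alpha' muy' mux' sg'
      where p: "p = (m, alpha, muy, mux, sg)" "Q m alpha muy mux sg"
        and p': "p' = (m', alpha', muy', mux', sg')" "Q m' alpha' muy' mux' sg'"
      by (auto simp: P_def)
    have m: "m' = m" using \<open>key p = key p'\<close> by (simp add: p p' key_def)
    note q = Q[OF p(2)] and q' = Q[OF p'(2), unfolded m]
    have res: "(\<lambda>k\<in>I m. \<lfloor>coord alpha muy mux sg k / \<delta>\<rfloor>) = (\<lambda>k\<in>I m. \<lfloor>coord alpha' muy' mux' sg' k / \<delta>\<rfloor>)"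
      using \<open>key p = key p'\<close> by (simp add: p p' key_def m)
    have cl: "\<bar>coord alpha muy mux sg k - coord alpha' muy' mux' sg' k\<bar> \<le> \<delta>" if "k \<in> I m" for k
      using fun_cong[OF res, of k] that \<delta>(1) by (intro abs_diff_le_floor_eq) simp_all
    have cl0: "\<bar>ln sg - ln sg'\<bar> \<le> \<delta>" using cl[of None] by (simp add: coord_def I_def)
    have cl1: "\<bar>muy j $ i - muy' j $ i\<bar> \<le> \<delta>" if "j < m" for i j
      using cl[of "Some (j, Inl i)"] that by (simp add: coord_def I_def)
    have cl2: "\<bar>mux j $ i - mux' j $ i\<bar> \<le> \<delta>" if "j < m" for i j
      using cl[of "Some (j, Inr (Inl i))"] that by (simp add: coord_def I_def)
    have cl3: "\<bar>ln (alpha j) - ln (alpha' j)\<bar> \<le> \<delta>" if "j < m" for j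
      using cl[of "Some (j, Inr (Inr ()))"] that by (simp add: coord_def I_def)
    have pos: "0 < alpha j" "0 < alpha' j" if "j < m" for j
      using q q' that exp_gt_zero[of "- (\<delta> * real K)"] by (meson less_le_trans)+
    \<comment> \<open>Since \<open>eps \<le> 1\<close>, the mesh condition
      \<open>2 * C * \<delta> * V \<le> eps\<^sup>2\<close> serves both distances: for
      \<open>dist_h\<close> the square root is taken, for \<open>dist_1\<close> one uses
      \<open>eps\<^sup>2 \<le> eps\<close>.\<close>
    have e2: "eps\<^sup>2 \<le> eps" using eps by (simp add: power2_eq_square)
    have "C * \<delta> * V \<le> 1"
      using \<delta>(3) e2 eps by linarith
    note d = mix_dens_dist_le[where sg = sg and sg' = sg' and muy = muy and muy' = muy' and alpha = alpha and alpha' = alpha'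
        and mux = mux and mux' = mux' and \<delta> = \<delta> and V = V and ?g0.0 = g0 and m = m, folded C_def,
        OF conjunct1[OF q] conjunct1[OF q'] pos V _ _ \<delta>(1) this cl3 cl0 cl1 cl2 g0_meas g0_nonneg g0_supp g0_int]
    have d1: "dist_1 g0 (f p) (f p') \<le> 2 * C * \<delta> * V" and dh: "dist_h g0 (f p) (f p') \<le> sqrt (2 * C * \<delta> * V)"
      using d q q' by (auto simp: f_def p p' m)
    have "sqrt (2 * C * \<delta> * V) \<le> eps" using \<delta>(3) eps by (intro real_le_lsqrt) auto
    then show "rho (f p) (f p') \<le> eps" using rho d1 dh \<delta>(3) e2 by auto
  qed
  also have "card Keys = (\<Sum>m\<le>h. (2 * K + 1) ^ (1 + m * (1 + CARD('dy) + CARD('dx))))"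
  proof -
    have "card {- int K..int K} = 2 * K + 1" by simp
    then have "card (PiE (I m) (\<lambda>_. {- int K..int K})) = (2 * K + 1) ^ (1 + m * (1 + CARD('dy) + CARD('dx)))" for m
      by (subst card_PiE[OF I(1)]) (simp only: prod_constant I(2))
    then show ?thesis unfolding Keys_def by (subst card_SigmaI) (auto intro!: finite_PiE I)
  qed
  also have "\<dots> \<le> (\<Sum>m\<le>h. (2 * K + 1) ^ (1 + h * (1 + CARD('dy) + CARD('dx))))"
    by (intro sum_mono power_increasing add_left_mono mult_right_mono) auto
  also have "\<dots> = (h + 1) * (2 * K + 1) ^ (1 + h * (1 + CARD('dy) + CARD('dx)))" by simp
  finally show ?thesis unfolding eq by simp
qed

section \<open>Tails of Gamma and Dirichlet distributions\<close>

lemma borel_measurable_gamma_density [measurable]: "gamma_density c \<in> borel_measurable borel"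
  unfolding gamma_density_def by measurable

lemma nn_integral_gamma_density:
  assumes "0 < c"
  shows "(\<integral>\<^sup>+ x. gamma_density c x \<partial>lborel) = 1"
proof -
  have G: "0 < Gamma c" using assms by (rule Gamma_real_pos)
  have "(\<integral>\<^sup>+ x. gamma_density c x \<partial>lborel)
      = (\<integral>\<^sup>+ x. ennreal (1 / Gamma c) * ennreal (indicator {0..} x * x powr (c - 1) / exp x) \<partial>lborel)"
  proof (intro nn_integral_cong)
    fix x :: real
    show "gamma_density c x = ennreal (1 / Gamma c) * ennreal (indicator {0..} x * x powr (c - 1) / exp x)"
      using G by (cases "x \<ge> 0")
        (auto simp: gamma_density_def exp_minus field_simps indicator_def simp flip: ennreal_mult)
  qed
  also have "\<dots> = ennreal (1 / Gamma c) * ennreal (Gamma c)"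
    by (subst nn_integral_cmult) (auto simp: Gamma_conv_nn_integral_real[OF assms])
  also have "\<dots> = 1" using G by (simp flip: ennreal_mult)
  finally show ?thesis .
qed

text \<open>Exponential Markov argument: beyond \<open>N\<close>,
  \<open>exp (- x) \<le> exp (- N / 2) * exp (- x / 2)\<close>, and the remaining Gamma integral
  with rate one half is \<open>2 powr c * Gamma c\<close>. The factor \<open>Gamma c\<close>
  cancels, so the bound does not blow up as \<open>c\<close> tends to 0.\<close>

lemma emeasure_gamma_upper_tail:
  assumes "0 < c" "0 \<le> N"
  shows "emeasure (density lborel (gamma_density c)) {N<..} \<le> ennreal (2 powr c * exp (- N / 2))"
proof -
  have G: "0 < Gamma c" using assms by (intro Gamma_real_pos)
  define f where "f x = ennreal (indicator {0..} x * x powr (c - 1) / exp (x / 2))" for x :: real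
  have [measurable]: "f \<in> borel_measurable borel" unfolding f_def by measurable
  have "(\<integral>\<^sup>+ x. f x \<partial>lborel) = ennreal \<bar>2\<bar> * (\<integral>\<^sup>+ x. f (0 + 2 * x) \<partial>lborel)"
    by (rule nn_integral_real_affine) (auto simp: f_def)
  also have "(\<integral>\<^sup>+ x. f (0 + 2 * x) \<partial>lborel)
      = (\<integral>\<^sup>+ x. ennreal (2 powr (c - 1)) * ennreal (indicator {0..} x * x powr (c - 1) / exp x) \<partial>lborel)"
    unfolding f_def by (intro nn_integral_cong)
      (auto simp: indicator_def powr_mult simp flip: ennreal_mult)
  also have "\<dots> = ennreal (2 powr (c - 1)) * ennreal (Gamma c)"
    by (subst nn_integral_cmult) (auto simp: Gamma_conv_nn_integral_real[OF assms(1)])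
  also have "ennreal \<bar>2\<bar> * (ennreal (2 powr (c - 1)) * ennreal (Gamma c)) = ennreal (2 * (2 powr (c - 1) * Gamma c))"
    using G by (simp add: ennreal_mult)
  also have "2 * (2 powr (c - 1) * Gamma c) = 2 powr c * Gamma c"
    by (simp add: powr_diff)
  finally have f: "(\<integral>\<^sup>+ x. f x \<partial>lborel) = ennreal (2 powr c * Gamma c)" .
  have "emeasure (density lborel (gamma_density c)) {N<..} = (\<integral>\<^sup>+ x. gamma_density c x * indicator {N<..} x \<partial>lborel)"
    by (subst emeasure_density) auto
  also have "\<dots> \<le> (\<integral>\<^sup>+ x. ennreal (exp (- N / 2) / Gamma c) * f x \<partial>lborel)"
  proof (intro nn_integral_mono)
    fix x :: real
    show "gamma_density c x * indicator {N<..} x \<le> ennreal (exp (- N / 2) / Gamma c) * f x"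
    proof (cases "x > N")
      case True
      have "exp (- x) \<le> exp (- N / 2) / exp (x / 2)"
        using True by (simp flip: exp_diff)
      then have "x powr (c - 1) * exp (- x) / Gamma c \<le> x powr (c - 1) * (exp (- N / 2) / exp (x / 2)) / Gamma c"
        using G by (intro divide_right_mono mult_left_mono) auto
      then show ?thesis
        using True assms G by (auto simp: gamma_density_def f_def mult_ac intro!: ennreal_leI simp flip: ennreal_mult)
    qed simp
  qed
  also have "\<dots> = ennreal (exp (- N / 2) / Gamma c) * ennreal (2 powr c * Gamma c)"
    by (subst nn_integral_cmult) (simp_all add: f)
  also have "\<dots> = ennreal (2 powr c * exp (- N / 2))"
    using G by (simp add: field_simps flip: ennreal_mult)
  finally show ?thesis .
qed

text \<open>Drop the factor \<open>exp (- x) \<le> 1\<close> and integrate the power. Writing the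
  constant as \<open>Gamma (c + 1) = c * Gamma c\<close> keeps it under control for small
  \<open>c\<close>.\<close>

lemma emeasure_gamma_lower_tail:
  assumes "0 < c" "0 \<le> u"
  shows "emeasure (density lborel (gamma_density c)) {..u} \<le> ennreal (u powr c / Gamma (c + 1))"
proof -
  have G: "0 < Gamma c" using assms by (intro Gamma_real_pos)
  have "((\<lambda>x. x powr (c - 1)) has_integral (u powr (c - 1 + 1) / (c - 1 + 1))) {0..u}"
    using assms by (intro has_integral_powr_from_0) auto
  from nn_integral_has_integral_lebesgue'[OF _ this]
  have int: "(\<integral>\<^sup>+ x. ennreal (x powr (c - 1)) * indicator {0..u} x \<partial>lborel) = ennreal (u powr c / c)" by simp
  have "emeasure (density lborel (gamma_density c)) {..u} = (\<integral>\<^sup>+ x. gamma_density c x * indicator {..u} x \<partial>lborel)"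
    by (subst emeasure_density) auto
  also have "\<dots> \<le> (\<integral>\<^sup>+ x. ennreal (1 / Gamma c) * (ennreal (x powr (c - 1)) * indicator {0..u} x) \<partial>lborel)"
    using G by (intro nn_integral_mono)
      (auto simp: gamma_density_def indicator_def field_simps mult_le_cancel_left1 intro!: ennreal_leI simp flip: ennreal_mult)
  also have "\<dots> = ennreal (1 / Gamma c) * ennreal (u powr c / c)"
    by (subst nn_integral_cmult) (auto simp: int)
  also have "\<dots> = ennreal (u powr c / Gamma (c + 1))"
  proof -
    have "Gamma (c + 1) = c * Gamma c"
      using assms by (intro Gamma_plus1) (auto elim!: nonpos_Ints_cases)
    then show ?thesis using G assms by (simp add: mult.commute flip: ennreal_mult)
  qed
  finally show ?thesis .
qed

text \<open>The Dirichlet parameter \<open>a / m\<close> tends to 0 with growing \<open>m\<close>,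
  so the constant in the lower tail must be uniform in it; \<open>Gamma\<close> is continuous and
  positive on the compact interval \<open>{1..a + 1}\<close>.\<close>

lemma Gamma_plus1_lower_bound:
  assumes "0 < (a::real)"
  shows "\<exists>\<gamma>>0. \<forall>c. 0 < c \<and> c \<le> a \<longrightarrow> \<gamma> \<le> Gamma (c + 1)"
proof -
  have "continuous_on {1..a + 1} (Gamma :: real \<Rightarrow> real)"
    by (intro continuous_on_Gamma) (auto elim!: nonpos_Ints_cases)
  then obtain z where z: "z \<in> {1..a + 1}" "\<And>y. y \<in> {1..a + 1} \<Longrightarrow> Gamma z \<le> Gamma y"
    using continuous_attains_inf[of "{1..a + 1}" "Gamma :: real \<Rightarrow> real"] assms by auto
  then show ?thesis
    by (intro exI[of _ "Gamma z"]) (auto intro!: Gamma_real_pos)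
qed

text \<open>If every underlying Gamma variable is above \<open>x * N * i\<close> and at most
  \<open>N\<close>, the total is positive and at most \<open>N * i\<close>, so every normalised
  weight is at least \<open>x\<close> and they sum to 1. The bad event therefore forces one variable
  out of this range, and a union bound over the marginals suffices.\<close>

lemma dirichlet_tail:
  assumes "1 \<le> i" "0 < c" "0 \<le> N" "0 < x"
  shows "measure (dirichlet i c) {\<alpha> \<in> space (PiM {..<i} (\<lambda>_. lborel)). \<not> ((\<forall>j<i. x \<le> \<alpha> j) \<and> (\<Sum>j<i. \<alpha> j) = 1)}
     \<le> real i * (2 powr c * exp (- N / 2) + (x * N * real i) powr c / Gamma (c + 1))"
proof -
  define G where "G = density lborel (gamma_density c)"
  define T where "T = PiM {..<i} (\<lambda>_. G)"
  define F where "F = (\<lambda>g. \<lambda>j\<in>{..<i}. g j / (\<Sum>k<i. g k :: real))"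
  define B where "B = {\<alpha> \<in> space (PiM {..<i} (\<lambda>_. lborel)). \<not> ((\<forall>j<i. x \<le> \<alpha> j) \<and> (\<Sum>j<i. \<alpha> j) = 1)}"
  define W where "W = {N<..} \<union> {..x * N * real i}"
  interpret G: prob_space G
    unfolding G_def by (rule prob_spaceI) (simp add: emeasure_density nn_integral_gamma_density assms)
  have setsG [measurable_cong]: "sets G = sets borel" by (simp add: G_def)
  have F [measurable]: "F \<in> measurable T (PiM {..<i} (\<lambda>_. lborel))"
    unfolding F_def T_def by measurable
  have B [measurable]: "B \<in> sets (PiM {..<i} (\<lambda>_. lborel))"
    unfolding B_def by measurable
  have W: "W \<in> sets G" unfolding W_def setsG by auto
  have p0: "0 \<le> 2 powr c * exp (- N / 2) + (x * N * real i) powr c / Gamma (c + 1)"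
    using Gamma_real_pos[of "c + 1"] assms by (intro add_nonneg_nonneg divide_nonneg_nonneg) auto
  have "emeasure (dirichlet i c) B = emeasure T (F -` B \<inter> space T)"
    unfolding dirichlet_def G_def[symmetric] T_def[symmetric] F_def[symmetric] by (rule emeasure_distr[OF F B])
  also have "\<dots> \<le> emeasure T (\<Union>j<i. {g \<in> space T. g j \<in> W})"
  proof (intro emeasure_mono subsetI)
    fix g assume g: "g \<in> F -` B \<inter> space T"
    show "g \<in> (\<Union>j<i. {g \<in> space T. g j \<in> W})"
    proof (rule ccontr)
      assume "\<not> ?thesis"
      then have "\<And>j. j < i \<Longrightarrow> g j \<notin> W" using g by auto
      then have up: "\<And>j. j < i \<Longrightarrow> g j \<le> N" and lo: "\<And>j. j < i \<Longrightarrow> x * N * real i < g j"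
        by (force simp: W_def)+
      have "0 \<le> x * N * real i" using assms by simp
      then have "\<And>j. j < i \<Longrightarrow> 0 < g j" using lo by (meson le_less_trans)
      then have s0: "0 < (\<Sum>k<i. g k)" using assms by (intro sum_pos) (auto simp: lessThan_empty_iff)
      have sN: "(\<Sum>k<i. g k) \<le> N * real i" using sum_mono[of "{..<i}" g "\<lambda>_. N"] up by (simp add: mult.commute)
      have "x \<le> g j / (\<Sum>k<i. g k)" if "j < i" for j
      proof -
        have "x * (\<Sum>k<i. g k) \<le> x * (N * real i)" using sN assms by (intro mult_left_mono) auto
        also have "\<dots> \<le> g j" using lo[OF that] by (simp add: mult.assoc)
        finally show ?thesis using s0 by (simp add: pos_le_divide_eq)
      qed
      moreover have "(\<Sum>j<i. g j / (\<Sum>k<i. g k)) = 1" using s0 by (simp flip: sum_divide_distrib)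
      ultimately have "F g \<notin> B" by (simp add: F_def B_def)
      then show False using g by simp
    qed
  qed (use W in \<open>auto simp: T_def\<close>)
  also have "\<dots> \<le> (\<Sum>j<i. emeasure T {g \<in> space T. g j \<in> W})"
    using W by (intro emeasure_subadditive_finite) (auto simp: T_def)
  also have "\<dots> \<le> (\<Sum>j<i. ennreal (2 powr c * exp (- N / 2) + (x * N * real i) powr c / Gamma (c + 1)))"
  proof (intro sum_mono)
    fix j assume "j \<in> {..<i}"
    then have "emeasure T {g \<in> space T. g j \<in> W} = emeasure (distr T G (\<lambda>g. g j)) W"
      using W by (subst emeasure_distr) (auto simp: T_def vimage_def Int_def conj_commute)
    also have "distr T G (\<lambda>g. g j) = G"
      unfolding T_def using \<open>j \<in> {..<i}\<close> by (intro distr_PiM_component) (auto intro: G.prob_space_axioms)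
    also have "emeasure G W \<le> emeasure G {N<..} + emeasure G {..x * N * real i}"
      unfolding W_def by (intro emeasure_subadditive) (auto simp: setsG)
    also have "\<dots> \<le> ennreal (2 powr c * exp (- N / 2)) + ennreal ((x * N * real i) powr c / Gamma (c + 1))"
      unfolding G_def using assms by (intro add_mono emeasure_gamma_upper_tail emeasure_gamma_lower_tail) auto
    also have "\<dots> = ennreal (2 powr c * exp (- N / 2) + (x * N * real i) powr c / Gamma (c + 1))"
      using Gamma_real_pos[of "c + 1"] assms by (subst ennreal_plus) auto
    finally show "emeasure T {g \<in> space T. g j \<in> W} \<le> \<dots>" .
  qed
  also have "\<dots> = ennreal (real i * (2 powr c * exp (- N / 2) + (x * N * real i) powr c / Gamma (c + 1)))"
    using p0 by (simp add: ennreal_mult ennreal_of_nat_eq_real_of_nat)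
  finally show ?thesis
    unfolding B_def[symmetric] measure_def using p0 assms by (intro enn2real_leI) auto
qed

section \<open>Entropy of the sieve\<close>

lemma eventually_ln_le_powr_ln:
  assumes "0 < \<theta>"
  shows "eventually (\<lambda>n::nat. ln (real n) \<le> real n powr \<theta> * ln (real n) powr r) sequentially"
  using assms by real_asymp

lemma eventually_powr_ln_div_ln_le:
  assumes "\<theta> < 1"
  shows "eventually (\<lambda>n::nat. real n powr \<theta> * ln (real n) powr r / ln (real n) \<le> real n) sequentially"
  using assms by real_asymp

lemma eventually_powr_minus_ln_le_1:
  assumes "0 < b"
  shows "eventually (\<lambda>n::nat. real n powr (- b) * ln (real n) powr r \<le> 1) sequentially"
  using assms by real_asymp

lemma eventually_inverse_square_le:
  assumes "b < 1"
  shows "eventually (\<lambda>n::nat. C / real n ^ 2 \<le> real n powr (- b) * ln (real n) powr r) sequentially"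
  using assms by real_asymp

lemma eventually_ln_powr_ln_ge:
  assumes "0 < \<theta>"
  shows "eventually (\<lambda>n::nat. \<theta> / 2 * ln (real n) \<le> ln (real n powr \<theta> * ln (real n) powr r / ln (real n))) sequentially"
  using assms by real_asymp

lemma eventually_powr_ln_dominates:
  assumes "0 < \<theta>" "0 < \<kappa>" "r < s"
  shows "eventually (\<lambda>n::nat. K + c * (real n powr \<theta> * ln (real n) powr r) \<le> \<kappa> * (real n powr \<theta> * ln (real n) powr s)) sequentially"
  using assms by real_asymp

lemma eventually_powr_ln_div_ln_ge:
  assumes "0 < \<theta>"
  shows "eventually (\<lambda>n::nat. K \<le> real n powr \<theta> * ln (real n) powr r / ln (real n)) sequentially"
  using assms by real_asymp

text \<open>Half of the exponential decay absorbs the polynomial factor, the other half yields the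
  right-hand side, because \<open>\<theta> < 1\<close>.\<close>

lemma eventually_exp_minus_le:
  assumes "0 < \<gamma>" "0 < \<theta>" "\<theta> < 1" "0 < K" "0 < c"
  shows "eventually (\<lambda>n::nat. K * real n powr p * exp (- \<gamma> * real n) \<le> exp (- c * (real n powr \<theta> * ln (real n) powr r))) sequentially"
proof -
  have "eventually (\<lambda>n::nat. c * (real n powr \<theta> * ln (real n) powr r) \<le> \<gamma> / 2 * real n) sequentially"
    using assms by real_asymp
  moreover have "((\<lambda>n::nat. K * real n powr p * exp (- (\<gamma> / 2) * real n)) \<longlongrightarrow> 0) sequentially"
    using assms by real_asymp
  then have "eventually (\<lambda>n::nat. K * real n powr p * exp (- (\<gamma> / 2) * real n) < 1) sequentially"
    by (rule order_tendstoD) simp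
  ultimately show ?thesis
  proof eventually_elim
    case (elim n)
    have "K * real n powr p * exp (- \<gamma> * real n)
        = (K * real n powr p * exp (- (\<gamma> / 2) * real n)) * exp (- (\<gamma> / 2) * real n)"
      by (simp add: mult.assoc mult_exp_exp field_simps)
    also have "\<dots> \<le> 1 * exp (- c * (real n powr \<theta> * ln (real n) powr r))"
      using elim assms by (intro mult_mono) auto
    finally show ?case by simp
  qed
qed

section \<open>The rate and the entropy bound\<close>

lemma rate_squared:
  assumes "2 \<le> n"
  shows "(rate beta d t n)\<^sup>2 = real n powr (- (2 * beta / (2 * beta + d))) * ln (real n) powr (2 * t)"
proof -
  have "0 < ln (real n)" using assms by simp
  then show ?thesis using assms
    unfolding rate_def power_mult_distrib by (simp add: powr_power mult.commute)
qed

text \<open>The exponent \<open>d / (2 * beta + d)\<close>, called \<open>\<theta>\<close> below,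
  lies strictly between 0 and 1 for positive \<open>d\<close>; all later comparisons are made in
  terms of it.\<close>

lemma n_rate_squared:
  assumes "2 \<le> n" "0 < beta" "0 \<le> d"
  shows "real n * (rate beta d t n)\<^sup>2 = real n powr (d / (2 * beta + d)) * ln (real n) powr (2 * t)"
proof -
  have "d / (2 * beta + d) = 1 + - (2 * beta / (2 * beta + d))"
    using assms by (simp add: field_simps)
  then have "real n powr (d / (2 * beta + d)) = real n * real n powr (- (2 * beta / (2 * beta + d)))"
    using assms by (simp only: powr_add) simp
  then show ?thesis using assms by (simp add: rate_squared mult.assoc)
qed

text \<open>The log of the number of cells is of order \<open>(1 + h) * ln n\<close>, with
  \<open>h\<close> the integer part of \<open>H\<close>. Here \<open>H * ln n\<close> is the squared
  rate times \<open>n\<close>, and the single \<open>ln n\<close> left over is eventually dominated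
  by the same quantity.\<close>

lemma sieve_entropy:
  fixes g0 :: "real^'dx \<Rightarrow> real" and rho :: "(real^'dy \<Rightarrow> real^'dx \<Rightarrow> real) \<Rightarrow> (real^'dy \<Rightarrow> real^'dx \<Rightarrow> real) \<Rightarrow> real"
  defines "d \<equiv> real (CARD('dy) + CARD('dx))"
  assumes pos: "0 < beta" "0 < a3" "0 < tau3"
    and g0_meas: "g0 \<in> borel_measurable borel"
    and g0_nonneg: "\<And>x. 0 \<le> g0 x"
    and g0_supp: "\<And>x. x \<notin> unit_cube \<Longrightarrow> g0 x = 0"
    and g0_int: "(\<integral>\<^sup>+ x. ennreal (g0 x) \<partial>lborel) = 1"
    and rho: "rho \<in> {dist_h g0, dist_1 g0}"
  shows "\<exists>c1>0. \<forall>\<^sub>F n in sequentially. \<exists>k. covering_number (rate beta d t n) (sieve beta d t a3 tau3 n) rho cond_densities = enat k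
      \<and> ln (real k) \<le> c1 * real n * (rate beta d t n)\<^sup>2"
proof -
  define C where "C = 2 * (1 + 2 * real CARD('dx)) + (2 * real CARD('dy) + 1) * real CARD('dy)"
  have "1 \<le> CARD('dy)" "1 \<le> CARD('dx)" by (simp_all add: Suc_le_eq)
  then have d: "2 \<le> d" unfolding d_def by linarith
  define \<theta> where "\<theta> = d / (2 * beta + d)"
  have \<theta>: "0 < \<theta>" "\<theta> < 1" using d pos by (auto simp: \<theta>_def field_simps)
  define b where "b = beta / (2 * beta + d)"
  have b: "0 < b" "2 * b < 1" using d pos by (auto simp: b_def field_simps)
  have "0 < C" unfolding C_def by (intro add_pos_nonneg) auto
  \<comment> \<open>\<open>n ^ k\<close> exceeds the precision bound \<open>n powr (1 / a3)\<close>
    by a factor of at least \<open>n\<^sup>2\<close>, so the mesh \<open>1 / n ^ k\<close> gives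
    \<open>\<delta> * V \<le> 1 / n\<^sup>2\<close>, which beats the squared rate. The coordinate
    range \<open>n ^ l\<close> covers the means, \<open>\<bar>ln sg\<bar> \<le> n\<close> and the
    log weights, bounded by \<open>n * H \<le> n\<^sup>2\<close>; \<open>p\<close> is the exponent
    of the ratio of range to mesh.\<close>
  define k where "k = nat \<lceil>1 / a3\<rceil> + 2"
  define l where "l = nat \<lceil>1 / tau3\<rceil> + 2"
  have k: "1 / a3 + 2 \<le> real k" using pos unfolding k_def by (simp add: of_nat_nat real_nat_ceiling_ge)
  have l: "1 / tau3 \<le> real l" "2 \<le> l" using pos real_nat_ceiling_ge[of "1 / tau3"] unfolding l_def by linarith+
  define p where "p = k + l"
  define c1 where "c1 = (real p + 2) * (3 + d)"
  have "c1 > 0" using d by (simp add: c1_def)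
  moreover have "eventually (\<lambda>n::nat. \<bar>1 / (2 * a3)\<bar> * ln (real n) \<le> real n) sequentially"
    using pos by real_asymp
  then have "\<forall>\<^sub>F n in sequentially. \<exists>k. covering_number (rate beta d t n) (sieve beta d t a3 tau3 n) rho cond_densities = enat k
      \<and> ln (real k) \<le> c1 * real n * (rate beta d t n)\<^sup>2"
    using eventually_ln_le_powr_ln[OF \<theta>(1), of "2 * t"] eventually_powr_ln_div_ln_le[OF \<theta>(2), of "2 * t"]
      eventually_powr_minus_ln_le_1[OF b(1), of t] eventually_inverse_square_le[OF b(2), of "2 * C" "2 * t"]
      eventually_ge_at_top[of 3]
  proof eventually_elim
    case (elim n)
    define u where "u = real n * (rate beta d t n)\<^sup>2"
    define H where "H = u / ln (real n)"
    define h where "h = nat \<lfloor>H\<rfloor>"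
    define \<delta> where "\<delta> = 1 / real n ^ k"
    define K where "K = n ^ p"
    define V where "V = real n powr (1 / a3)"
    \<comment> \<open>From \<open>n = 3\<close> on, \<open>ln n\<close> is at least 1, and the
      factor 3 in \<open>2 * K + 1 \<le> 3 * n ^ p\<close> can be replaced by
      \<open>n\<close>.\<close>
    have n: "3 \<le> n" by fact
    have u: "u = real n powr \<theta> * ln (real n) powr (2 * t)"
      using n pos d unfolding u_def \<theta>_def by (intro n_rate_squared) auto
    have "exp 1 \<le> real n" using e_less_272 n by linarith
    then have ln1: "1 \<le> ln (real n)" using n by (simp add: ln_ge_iff)
    have "0 \<le> H" unfolding H_def u_def using ln1 by simp
    have Hn: "H \<le> real n" using elim(3) by (simp add: H_def u)
    have mh: "m \<le> h \<longleftrightarrow> real m \<le> H" for m using \<open>0 \<le> H\<close> by (simp add: h_def le_nat_iff le_floor_iff)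
    have hH: "real h \<le> H" using mh[of h] by simp
    have rate: "0 < rate beta d t n" "rate beta d t n \<le> 1"
      using n ln1 elim(4) by (auto simp: rate_def b_def)
    have rsq: "(rate beta d t n)\<^sup>2 = real n powr (- (2 * b)) * ln (real n) powr (2 * t)"
      using n by (simp add: rate_squared b_def)
    have n2: "real n ^ 2 \<le> real n ^ l" using n l by (intro power_increasing) auto
    have nn2: "real n \<le> real n ^ 2" using n by (simp add: power2_eq_square)
    have \<delta>K: "\<delta> * real K = real n ^ l" using n by (simp add: \<delta>_def K_def p_def power_add)
    have \<delta>0: "0 < \<delta>" "1 \<le> \<delta> * real K" using n by (auto simp: \<delta>K one_le_power) (simp add: \<delta>_def)
    have V1: "1 \<le> V" using n pos by (simp add: V_def ge_one_powr_ge_zero)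
    have "V * real n ^ 2 = real n powr (1 / a3 + 2)" using n by (simp add: V_def powr_add)
    also have "\<dots> \<le> real n powr (real k)" using n k by (intro powr_mono) auto
    also have "\<dots> = real n ^ k" using n by (simp add: powr_realpow)
    finally have "\<delta> * V \<le> 1 / real n ^ 2" using n by (simp add: \<delta>_def field_simps)
    then have "2 * C * (\<delta> * V) \<le> 2 * C * (1 / real n ^ 2)" using \<open>0 < C\<close> by (intro mult_left_mono) auto
    then have \<delta>V: "2 * C * \<delta> * V \<le> (rate beta d t n)\<^sup>2" using elim(5) by (simp add: rsq mult.assoc)
    have Q: "valid_param m alpha mux sg \<and> m \<le> h \<and> 1 / sg\<^sup>2 \<le> V \<and> \<bar>ln sg\<bar> \<le> \<delta> * real K
        \<and> (\<forall>j<m. exp (- (\<delta> * real K)) \<le> alpha j) \<and> (\<forall>j<m. \<forall>i. \<bar>muy j $ i\<bar> \<le> \<delta> * real K)"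
      if "valid_param m alpha mux sg \<and> sieve_cond beta d t a3 tau3 n m alpha muy sg"
      for m alpha and muy :: "nat \<Rightarrow> real^'dy" and mux :: "nat \<Rightarrow> real^'dx" and sg
    proof -
      have v: "valid_param m alpha mux sg" using that by simp
      have s: "real m \<le> H" "\<And>j. j < m \<Longrightarrow> exp (- real n * H) \<le> alpha j" "real n powr (- 1 / (2 * a3)) \<le> sg" "sg \<le> exp (real n)"
        "\<And>j i. j < m \<Longrightarrow> \<bar>muy j $ i\<bar> \<le> real n powr (1 / tau3)"
        using that unfolding sieve_cond_def Let_def u_def[symmetric] H_def[symmetric] by auto
      have sg: "0 < sg" using v by (simp add: valid_param_def)
      have "(real n powr (- 1 / (2 * a3)))\<^sup>2 = real n powr (- (1 / a3))" using n by (subst powr_power) auto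
      then have "1 / V = (real n powr (- 1 / (2 * a3)))\<^sup>2" by (simp add: V_def powr_minus_divide)
      also have "\<dots> \<le> sg\<^sup>2" using s(3) by (intro power_mono) auto
      finally have "1 / sg\<^sup>2 \<le> V" using sg V1 by (simp add: field_simps)
      moreover have "\<bar>ln sg\<bar> \<le> \<delta> * real K"
      proof -
        have up: "ln sg \<le> real n" using s(4) sg by (metis exp_gt_zero ln_exp ln_le_cancel_iff)
        have "- 1 / (2 * a3) * ln (real n) = ln (real n powr (- 1 / (2 * a3)))" using n by (simp add: ln_powr)
        also have "\<dots> \<le> ln sg" using s(3) n sg by (subst ln_le_cancel_iff) auto
        finally have "- real n \<le> ln sg" using elim(1) pos by simp
        then show ?thesis unfolding \<delta>K using up nn2 n2 by linarith
      qed
      moreover have "exp (- (\<delta> * real K)) \<le> alpha j" if "j < m" for j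
      proof -
        have "real n * H \<le> real n * real n" using Hn by (intro mult_left_mono) auto
        also have "\<dots> \<le> \<delta> * real K" using n2 by (simp add: \<delta>K power2_eq_square)
        finally show ?thesis using s(2)[OF that] by (intro order_trans[OF _ s(2)[OF that]]) simp
      qed
      moreover have "\<bar>muy j $ i\<bar> \<le> \<delta> * real K" if "j < m" for i j
      proof -
        have "real n powr (1 / tau3) \<le> real n powr real l" using n l by (intro powr_mono) auto
        also have "\<dots> = \<delta> * real K" using n by (simp add: \<delta>K powr_realpow)
        finally show ?thesis using s(5)[OF that, of i] by linarith
      qed
      ultimately show ?thesis using v s(1) mh by simp
    qed
    have "covering_number (rate beta d t n) (sieve beta d t a3 tau3 n) rho cond_densities
        \<le> enat ((h + 1) * (2 * K + 1) ^ (1 + h * (1 + CARD('dy) + CARD('dx))))"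
      unfolding sieve_def
      by (rule covering_number_mix_dens_le[where \<delta> = \<delta> and V = V, OF Q \<delta>0 \<delta>V[unfolded C_def] rate V1
            g0_meas g0_nonneg g0_supp g0_int rho])
    then obtain q where q: "covering_number (rate beta d t n) (sieve beta d t a3 tau3 n) rho cond_densities = enat q"
      "q \<le> (h + 1) * (2 * K + 1) ^ (1 + h * (1 + CARD('dy) + CARD('dx)))"
      by (metis enat_ile enat_ord_simps(1))
    have u0: "0 \<le> u" by (simp add: u_def)
    have "ln (real q) \<le> c1 * u"
    \<comment> \<open>An empty sieve has covering number 0; then \<open>ln 0 = 0\<close> and the
      bound is trivial.\<close>
    proof (cases "q = 0")
      case False
      then have "ln (real q) \<le> ln (real ((h + 1) * (2 * K + 1) ^ (1 + h * (1 + CARD('dy) + CARD('dx)))))"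
        using q(2) by (subst ln_le_cancel_iff) (auto simp del: of_nat_mult of_nat_power of_nat_add)
      also have "\<dots> = ln (real h + 1) + (1 + real h * (1 + d)) * ln (2 * real K + 1)"
      proof -
        define e where "e = 1 + h * (1 + CARD('dy) + CARD('dx))"
        have e: "real e = 1 + real h * (1 + d)" by (simp add: e_def d_def algebra_simps)
        have "real ((h + 1) * (2 * K + 1) ^ e) = (real h + 1) * (2 * real K + 1) ^ e"
          unfolding of_nat_mult of_nat_power of_nat_add by simp
        moreover have "ln ((real h + 1) * (2 * real K + 1) ^ e) = ln (real h + 1) + real e * ln (2 * real K + 1)"
          by (subst ln_mult) (auto simp: ln_realpow add_nonneg_pos)
        ultimately show ?thesis unfolding e_def[symmetric] e[symmetric] by simp
      qed
      also have "\<dots> \<le> real h * ln (real n) + (1 + real h * (1 + d)) * ((real p + 1) * ln (real n))"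
      proof (intro add_mono mult_left_mono)
        show "ln (real h + 1) \<le> real h * ln (real n)"
          using ln_add_one_self_le_self[of "real h"] ln1 mult_left_mono[of 1 "ln (real n)" "real h"] by (simp add: add.commute)
        show "ln (2 * real K + 1) \<le> (real p + 1) * ln (real n)"
        proof -
          have "1 \<le> real n ^ p" using n by (simp add: one_le_power)
          then have "2 * real K + 1 \<le> 3 * real n ^ p" by (simp add: K_def)
          also have "\<dots> \<le> real n * real n ^ p" using n by (intro mult_right_mono) auto
          finally have "ln (2 * real K + 1) \<le> ln (real n ^ (p + 1))" using n by (subst ln_le_cancel_iff) auto
          also have "\<dots> = (real p + 1) * ln (real n)" using n by (subst ln_realpow) auto
          finally show ?thesis .
        qed
        show "0 \<le> 1 + real h * (1 + d)" using d by simp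
      qed
      also have "\<dots>
         \<le> (real p + 2) * (ln (real n) + (2 + d) * (real h * ln (real n)))"
      proof -
        \<comment> \<open>This nonnegative sum is exactly the difference of the two sides.\<close>
        have "0 \<le> ln (real n) + real h * ln (real n) * (1 + d) + real p * (real h * ln (real n)) + real h * ln (real n)"
          using ln1 d by (intro add_nonneg_nonneg mult_nonneg_nonneg) auto
        then show ?thesis by (simp add: algebra_simps)
      qed
      also have "\<dots> \<le> (real p + 2) * (u + (2 + d) * u)"
      proof -
        have "real h * ln (real n) \<le> H * ln (real n)" using hH ln1 by (intro mult_right_mono) auto
        also have "\<dots> = u" using ln1 by (simp add: H_def)
        finally show ?thesis using elim(2) d by (intro mult_left_mono add_mono) (auto simp: u)
      qed
      also have "\<dots> = c1 * u" by (simp add: c1_def algebra_simps)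
      finally show ?thesis .
    qed (use \<open>0 < c1\<close> u0 in simp)
    then show ?case using q(1) by (auto simp: u_def mult.assoc)
  qed
  ultimately show ?thesis by blast
qed

section \<open>Prior mass outside the sieve\<close>

lemma unit_cube_eq_cbox: "unit_cube = cbox 0 1"
  by (auto simp: unit_cube_def mem_box_cart)

text \<open>Above \<open>H\<close> the factor \<open>ln k powr r\<close> is at least
  \<open>L = ln H powr r\<close>, so the probabilities are dominated by a geometric sequence with
  ratio \<open>exp (- b * L)\<close>. The condition \<open>exp 1 \<le> H\<close> gives
  \<open>L \<ge> 1\<close>, hence a ratio of at most \<open>exp (- b)\<close> and a constant
  independent of \<open>H\<close>; it also keeps the indices above 2, where the formula for the
  probabilities applies.\<close>

lemma component_count_tail:
  fixes Pi :: "'p measure" and M :: "'p \<Rightarrow> nat"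
  assumes "prob_space Pi" and meas_M: "M \<in> measurable Pi (count_space UNIV)"
    and C: "0 < C" and M: "\<And>i. 2 \<le> i \<Longrightarrow> measure Pi {\<omega>\<in>space Pi. M \<omega> = i} = C * exp (- b * real i * ln (real i) powr r)"
    and b: "0 < b" and r: "0 \<le> r" and H: "exp 1 \<le> H"
  shows "measure Pi {\<omega>\<in>space Pi. H < real (M \<omega>)} \<le> C / (1 - exp (- b)) * exp (- b * ln H powr r * H)"
proof -
  interpret prob_space Pi by fact
  note [measurable] = meas_M
  have H2: "2 < H" using H exp_ge_add_one_self[of 1] e_less_272 exp_lower_Taylor_quadratic[of 1] by (simp add: power2_eq_square)
  \<comment> \<open>\<open>h + 1\<close> is the least integer above \<open>H\<close>: the tail is
    the union over \<open>i\<close> of the events \<open>M \<omega> = i + (h + 1)\<close>, and the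
    leading power \<open>q ^ (h + 1)\<close> is at most \<open>exp (- b * L * H)\<close>.\<close>
  define h where "h = nat \<lfloor>H\<rfloor>"
  have h: "H < real h + 1" "real h \<le> H" "2 \<le> h" using H2 unfolding h_def by linarith+
  define L where "L = ln H powr r"
  have lnH: "1 \<le> ln H" using H H2 by (simp add: ln_ge_iff)
  then have L: "1 \<le> L" using r by (simp add: L_def ge_one_powr_ge_zero)
  define q where "q = exp (- b * L)"
  have q: "0 < q" "q \<le> exp (- b)" using L b by (auto simp: q_def)
  have q1: "q < 1" using L b by (simp add: q_def)
  have le: "prob {\<omega>\<in>space Pi. M \<omega> = i + (h + 1)} \<le> C * q ^ (h + 1) * q ^ i" for i
  proof -
    define k where "k = i + (h + 1)"
    have "ln H \<le> ln (real k)" using h H2 by (subst ln_le_cancel_iff) (auto simp: k_def)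
    then have "L \<le> ln (real k) powr r" unfolding L_def using lnH r by (intro powr_mono2) auto
    then have "b * real k * L \<le> b * real k * ln (real k) powr r" using b by (intro mult_left_mono) auto
    then have "exp (- b * real k * ln (real k) powr r) \<le> exp (real k * (- b * L))" by (simp add: mult_ac)
    also have "\<dots> = q ^ k" unfolding q_def by (rule exp_of_nat_mult)
    finally have "C * exp (- b * real k * ln (real k) powr r) \<le> C * q ^ k" using C by simp
    then show ?thesis using M[of k] h by (simp add: k_def power_add mult_ac)
  qed
  have geo: "summable (\<lambda>i. C * q ^ (h + 1) * q ^ i)" using q q1 by (intro summable_mult summable_geometric) auto
  have sm: "summable (\<lambda>i. prob {\<omega>\<in>space Pi. M \<omega> = i + (h + 1)})"
    by (rule summable_comparison_test'[OF geo, of 0]) (use le in auto)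
  have eq: "{\<omega>\<in>space Pi. H < real (M \<omega>)} = (\<Union>i. {\<omega>\<in>space Pi. M \<omega> = i + (h + 1)})"
  proof (intro set_eqI iffI)
    fix \<omega> assume "\<omega> \<in> {\<omega>\<in>space Pi. H < real (M \<omega>)}"
    then have "\<omega> \<in> space Pi" "M \<omega> = (M \<omega> - (h + 1)) + (h + 1)" using h by auto
    then show "\<omega> \<in> (\<Union>i. {\<omega>\<in>space Pi. M \<omega> = i + (h + 1)})" by blast
  qed (use h in auto)
  have "prob {\<omega>\<in>space Pi. H < real (M \<omega>)} \<le> (\<Sum>i. prob {\<omega>\<in>space Pi. M \<omega> = i + (h + 1)})"
    unfolding eq using sm by (intro finite_measure_subadditive_countably) auto
  also have "\<dots> \<le> (\<Sum>i. C * q ^ (h + 1) * q ^ i)" by (intro suminf_le le sm geo)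
  also have "\<dots> = C * q ^ (h + 1) * (1 / (1 - q))"
    using q q1 by (subst suminf_mult) (auto simp: suminf_geometric summable_geometric)
  also have "\<dots> \<le> C * exp (- b * L * H) * (1 / (1 - exp (- b)))"
  proof (intro mult_mono mult_left_mono divide_left_mono)
    have "q ^ (h + 1) = exp (real (h + 1) * (- b * L))" unfolding q_def by (rule exp_of_nat_mult[symmetric])
    also have "\<dots> \<le> exp (- b * L * H)"
    proof -
      have "b * L * H \<le> b * L * real (h + 1)" using h b L by (intro mult_left_mono) auto
      then show ?thesis by (simp add: algebra_simps)
    qed
    finally show "q ^ (h + 1) \<le> exp (- b * L * H)" .
  qed (use q q1 b C in auto)
  finally show ?thesis by (simp add: L_def mult_ac)
qed

text \<open>This explains the weight cutoff \<open>exp (- n * H)\<close>: the small Dirichlet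
  parameter \<open>a / i\<close> weakens the exponent \<open>n * H\<close> to
  \<open>n * H * a / i\<close>, which is still at least \<open>a * n\<close> because
  \<open>i \<le> H\<close>. The remaining factor is polynomial in \<open>n\<close>.\<close>

lemma powr_quotient_bound:
  fixes n H a i :: real
  assumes "1 \<le> n" "0 < a" "1 \<le> i" "i \<le> H" "i \<le> n"
  shows "(exp (- n * H) * n * i) powr (a / i) \<le> exp (- a * n) * n powr (2 * a)"
proof -
  have "(exp (- n * H) * n * i) powr (a / i) = exp (- n * H) powr (a / i) * (n * i) powr (a / i)"
    using assms by (simp add: powr_mult mult.assoc)
  also have "\<dots> \<le> exp (- a * n) * n powr (2 * a)"
  proof (intro mult_mono)
    have "a * n * i \<le> a * n * H" using assms by (intro mult_left_mono) auto
    then have "- n * H * (a / i) \<le> - a * n" using assms by (simp add: field_simps)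
    then show "exp (- n * H) powr (a / i) \<le> exp (- a * n)" by (simp add: powr_def mult.commute)
    have "(n * i) powr (a / i) \<le> (n * i) powr a"
    proof (intro powr_mono)
      show "a / i \<le> a" using assms by (simp add: field_simps)
      show "1 \<le> n * i" using assms mult_mono[of 1 n 1 i] by simp
    qed
    also have "\<dots> \<le> (n * n) powr a" using assms by (intro powr_mono2 mult_left_mono) auto
    also have "\<dots> = n powr (2 * a)" using assms by (simp add: powr_mult powr_add[symmetric])
    finally show "(n * i) powr (a / i) \<le> n powr (2 * a)" .
  qed auto
  finally show ?thesis .
qed

text \<open>The Dirichlet law of the weights is given on each event \<open>M \<omega> = i\<close>,
  hence the split over \<open>i\<close>. With \<open>N = n\<close> in the tail bound each
  \<open>i\<close> costs a factor of at most \<open>n\<close>, and there are at most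
  \<open>n\<close> values of \<open>i\<close>; \<open>\<gamma>\<close> replaces
  \<open>Gamma (c + 1)\<close> uniformly in \<open>c = a / i\<close>.\<close>

lemma weight_tail:
  fixes Pi :: "'p measure" and M :: "'p \<Rightarrow> nat" and A :: "'p \<Rightarrow> nat \<Rightarrow> real"
  assumes "prob_space Pi"
    and meas_M: "M \<in> measurable Pi (count_space UNIV)"
    and meas_A: "\<And>j. (\<lambda>\<omega>. A \<omega> j) \<in> borel_measurable Pi"
    and P4: "\<And>i B. 1 \<le> i \<Longrightarrow> B \<in> sets (PiM {..<i} (\<lambda>_. lborel)) \<Longrightarrow>
               measure Pi {\<omega>\<in>space Pi. M \<omega> = i \<and> restrict (A \<omega>) {..<i} \<in> B}
               = measure Pi {\<omega>\<in>space Pi. M \<omega> = i} * measure (dirichlet i (a / real i)) B"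
    and a: "0 < a" and \<gamma>: "0 < \<gamma>" "\<And>c. 0 < c \<Longrightarrow> c \<le> a \<Longrightarrow> \<gamma> \<le> Gamma (c + 1)"
    and n: "1 \<le> n" and H: "0 \<le> H" "H \<le> real n"
  shows "\<exists>E\<in>sets Pi. {\<omega>\<in>space Pi. 1 \<le> M \<omega> \<and> real (M \<omega>) \<le> H \<and>
        \<not> ((\<forall>j<M \<omega>. exp (- real n * H) \<le> A \<omega> j) \<and> (\<Sum>j<M \<omega>. A \<omega> j) = 1)} \<subseteq> E
     \<and> measure Pi E \<le> real n powr 2 * (2 powr a * exp (- real n / 2) + exp (- a * real n) * real n powr (2 * a) / \<gamma>)"
proof -
  interpret prob_space Pi by fact
  note [measurable] = meas_M meas_A
  define h where "h = nat \<lfloor>H\<rfloor>"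
  have mh: "m \<le> h \<longleftrightarrow> real m \<le> H" for m using H by (simp add: h_def le_nat_iff le_floor_iff)
  have hn: "real h \<le> real n" using mh[of h] H by simp
  define x where "x = exp (- real n * H)"
  define B where "B i = {\<alpha> \<in> space (PiM {..<i} (\<lambda>_. lborel)). \<not> ((\<forall>j<i. x \<le> \<alpha> j) \<and> (\<Sum>j<i. \<alpha> j) = 1)}" for i :: nat
  have B [measurable]: "B i \<in> sets (PiM {..<i} (\<lambda>_. lborel))" for i
    unfolding B_def by measurable
  have res [measurable]: "(\<lambda>\<omega>. restrict (A \<omega>) {..<i}) \<in> measurable Pi (PiM {..<i} (\<lambda>_. lborel))" for i
    by (rule measurable_restrict) simp
  define E where "E = (\<Union>i\<in>{1..h}. {\<omega>\<in>space Pi. M \<omega> = i \<and> restrict (A \<omega>) {..<i} \<in> B i})"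
  define R where "R = 2 powr a * exp (- real n / 2) + exp (- a * real n) * real n powr (2 * a) / \<gamma>"
  have R0: "0 \<le> R" using \<gamma> by (simp add: R_def)
  have Es: "{\<omega>\<in>space Pi. M \<omega> = i \<and> restrict (A \<omega>) {..<i} \<in> B i} \<in> sets Pi" for i by measurable
  have "prob E \<le> (\<Sum>i\<in>{1..h}. prob {\<omega>\<in>space Pi. M \<omega> = i \<and> restrict (A \<omega>) {..<i} \<in> B i})"
    unfolding E_def using Es by (intro finite_measure_subadditive_finite) auto
  also have "\<dots> \<le> (\<Sum>i\<in>{1..h}. real n * R)"
  proof (intro sum_mono)
    fix i assume "i \<in> {1..h}"
    then have i: "1 \<le> i" "i \<le> h" by auto
    define c where "c = a / real i"
    have c: "0 < c" "c \<le> a" using a i by (auto simp: c_def field_simps)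
    have iH: "real i \<le> H" "real i \<le> real n" using i mh[of i] hn by auto
    have "prob {\<omega>\<in>space Pi. M \<omega> = i \<and> restrict (A \<omega>) {..<i} \<in> B i}
       = prob {\<omega>\<in>space Pi. M \<omega> = i} * measure (dirichlet i c) (B i)"
      unfolding c_def using i by (intro P4 B) auto
    also have "\<dots> \<le> 1 * measure (dirichlet i c) (B i)"
      by (intro mult_right_mono) auto
    also have "\<dots> \<le> real i * (2 powr c * exp (- real n / 2) + (x * real n * real i) powr c / Gamma (c + 1))"
      unfolding B_def using dirichlet_tail[of i c "real n" x] i c by (simp add: x_def)
    also have "\<dots> \<le> real n * R"
      unfolding R_def
    proof (intro mult_mono add_mono frac_le)
      show "2 powr c \<le> 2 powr a" using c by simp
      show "(x * real n * real i) powr c \<le> exp (- a * real n) * real n powr (2 * a)"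
        unfolding x_def c_def using n a i iH by (intro powr_quotient_bound) auto
    qed (use \<gamma> c iH in auto)
    finally show "prob {\<omega>\<in>space Pi. M \<omega> = i \<and> restrict (A \<omega>) {..<i} \<in> B i} \<le> real n * R" .
  qed
  also have "\<dots> = real h * (real n * R)" by simp
  also have "\<dots> \<le> real n * (real n * R)" using hn R0 by (intro mult_right_mono) auto
  also have "\<dots> = real n powr 2 * R" using n by (simp add: power2_eq_square)
  finally have "prob E \<le> real n powr 2 * R" .
  moreover have "E \<in> sets Pi" unfolding E_def using Es by auto
  moreover have "{\<omega>\<in>space Pi. 1 \<le> M \<omega> \<and> real (M \<omega>) \<le> H \<and>
        \<not> ((\<forall>j<M \<omega>. exp (- real n * H) \<le> A \<omega> j) \<and> (\<Sum>j<M \<omega>. A \<omega> j) = 1)} \<subseteq> E"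
    by (auto simp: E_def B_def x_def mh space_PiM)
  ultimately show ?thesis unfolding R_def by blast
qed

text \<open>Lying outside the sieve is a condition on all parametrisations of a mixture, so the
  bound is stated for a measurable superset, outside which the sampled parameters themselves meet
  the sieve conditions. The constant 6 counts two bounds for the weights and one each for the number
  of components, small scales, large scales and the means.\<close>

lemma sieve_prior_mass:
  fixes Pi :: "'p measure"
    and M :: "'p \<Rightarrow> nat" and A :: "'p \<Rightarrow> nat \<Rightarrow> real"
    and MY :: "'p \<Rightarrow> nat \<Rightarrow> real^'dy" and MX :: "'p \<Rightarrow> nat \<Rightarrow> real^'dx"
    and S :: "'p \<Rightarrow> real"
  assumes prob: "prob_space Pi"
    and meas_M: "M \<in> measurable Pi (count_space UNIV)"
    and meas_A: "\<And>j. (\<lambda>\<omega>. A \<omega> j) \<in> borel_measurable Pi"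
    and meas_S: "S \<in> borel_measurable Pi"
    and meas_MY: "\<And>j. (\<lambda>\<omega>. MY \<omega> j) \<in> borel_measurable Pi"
    and meas_MX: "\<And>j. (\<lambda>\<omega>. MX \<omega> j) \<in> borel_measurable Pi"
    and param_dom: "AE \<omega> in Pi. 1 \<le> M \<omega> \<and> 0 < S \<omega>"
    and pos: "0 < beta" "0 < d" "0 < a" "0 < a1" "0 < a2" "0 < a3" "0 < a4" "0 < a5" "0 < a10" "0 < a13" "0 < tau3"
    and tau1: "0 \<le> tau1"
    and P1: "\<exists>s0. \<forall>s\<ge>s0. measure Pi {\<omega>\<in>space Pi. s \<le> 1 / (S \<omega>)\<^sup>2} \<le> a1 * exp (- a2 * s powr a3)"
    and P2: "\<exists>\<delta>>0. \<forall>s. 0 < s \<and> s < \<delta> \<longrightarrow> measure Pi {\<omega>\<in>space Pi. 1 / (S \<omega>)\<^sup>2 < s} \<le> a4 * s powr a5"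
    and P4: "\<And>i B. 1 \<le> i \<Longrightarrow> B \<in> sets (PiM {..<i} (\<lambda>_. lborel)) \<Longrightarrow>
               measure Pi {\<omega>\<in>space Pi. M \<omega> = i \<and> restrict (A \<omega>) {..<i} \<in> B}
               = measure Pi {\<omega>\<in>space Pi. M \<omega> = i} * measure (dirichlet i (a / real i)) B"
    and P5: "\<exists>C>0. \<forall>i::nat. 2 \<le> i \<longrightarrow>
               measure Pi {\<omega>\<in>space Pi. M \<omega> = i} = C * exp (- a10 * real i * ln (real i) powr tau1)"
    and P6_x: "\<And>j. \<exists>h. distributed Pi lborel (\<lambda>\<omega>. MX \<omega> j) h \<and> (\<forall>x. x \<notin> unit_cube \<longrightarrow> h x = 0)"
    and P6_tail: "\<exists>r0. \<forall>r\<ge>r0. \<forall>j.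
               1 - measure Pi {\<omega>\<in>space Pi. \<forall>i. \<bar>MY \<omega> j $ i\<bar> \<le> r} \<le> exp (- a13 * r powr tau3)"
    and t: "t > t0 + (1 - tau1) / 2" and c: "0 < c"
  shows "\<forall>\<^sub>F n in sequentially. \<exists>E\<in>sets Pi.
      {\<omega>\<in>space Pi. mix_dens (M \<omega>) (A \<omega>) (MY \<omega>) (MX \<omega>) (S \<omega>) \<notin> sieve beta d t a3 tau3 n} \<subseteq> E
      \<and> measure Pi E \<le> 6 * exp (- c * real n * (rate beta d t0 n)\<^sup>2)"
proof -
  interpret prob_space Pi by fact
  note [measurable] = meas_M meas_A meas_S meas_MY meas_MX
  define \<theta> where "\<theta> = d / (2 * beta + d)"
  have \<theta>: "0 < \<theta>" "\<theta> < 1" using pos by (auto simp: \<theta>_def field_simps)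
  define w where "w n = exp (- c * (real n powr \<theta> * ln (real n) powr (2 * t0)))" for n :: nat
  \<comment> \<open>The density of each location vanishes off the cube. The null set
    \<open>E0\<close> collects the outcomes with a location outside the cube, no component or a
    nonpositive scale; weights not summing to 1 are treated with the weight cutoff.\<close>
  have "AE \<omega> in Pi. MX \<omega> j \<in> unit_cube" for j
  proof -
    obtain h where h: "distributed Pi lborel (\<lambda>\<omega>. MX \<omega> j) h" "\<And>x. x \<notin> unit_cube \<Longrightarrow> h x = 0"
      using P6_x by blast
    have "emeasure Pi ((\<lambda>\<omega>. MX \<omega> j) -` (- unit_cube) \<inter> space Pi) = (\<integral>\<^sup>+ x. h x * indicator (- unit_cube) x \<partial>lborel)"
      by (rule distributed_emeasure[OF h(1)]) (simp add: unit_cube_eq_cbox borel_comp)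
    also have "\<dots> = (\<integral>\<^sup>+ x. 0 \<partial>(lborel :: (real^'dx) measure))"
      using h(2) by (intro nn_integral_cong) (auto simp: indicator_def)
    finally have "emeasure Pi ((\<lambda>\<omega>. MX \<omega> j) -` (- unit_cube) \<inter> space Pi) = 0" by simp
    moreover have "(\<lambda>\<omega>. MX \<omega> j) -` (- unit_cube) \<inter> space Pi \<in> sets Pi"
      by (rule measurable_sets[OF meas_MX]) (simp add: unit_cube_eq_cbox borel_comp)
    ultimately show ?thesis by (intro AE_I) auto
  qed
  then have "AE \<omega> in Pi. (1 \<le> M \<omega> \<and> 0 < S \<omega>) \<and> (\<forall>j. MX \<omega> j \<in> unit_cube)"
    using param_dom by (simp add: AE_all_countable)
  then obtain E0 where E0: "{\<omega>\<in>space Pi. \<not> ((1 \<le> M \<omega> \<and> 0 < S \<omega>) \<and> (\<forall>j. MX \<omega> j \<in> unit_cube))} \<subseteq> E0"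
    "emeasure Pi E0 = 0" "E0 \<in> sets Pi" by (rule AE_E)
  obtain s0 where s0: "\<And>s. s \<ge> s0 \<Longrightarrow> prob {\<omega>\<in>space Pi. s \<le> 1 / (S \<omega>)\<^sup>2} \<le> a1 * exp (- a2 * s powr a3)"
    using P1 by blast
  obtain \<delta> where \<delta>: "0 < \<delta>" "\<And>s. 0 < s \<Longrightarrow> s < \<delta> \<Longrightarrow> prob {\<omega>\<in>space Pi. 1 / (S \<omega>)\<^sup>2 < s} \<le> a4 * s powr a5"
    using P2 by blast
  obtain C where C: "0 < C" "\<And>i::nat. 2 \<le> i \<Longrightarrow> prob {\<omega>\<in>space Pi. M \<omega> = i} = C * exp (- a10 * real i * ln (real i) powr tau1)"
    using P5 by blast
  obtain r0 where r0: "\<And>r j. r \<ge> r0 \<Longrightarrow> 1 - prob {\<omega>\<in>space Pi. \<forall>i. \<bar>MY \<omega> j $ i\<bar> \<le> r} \<le> exp (- a13 * r powr tau3)"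
    using P6_tail by blast
  obtain \<gamma> where \<gamma>: "0 < \<gamma>" "\<And>b. 0 < b \<Longrightarrow> b \<le> a \<Longrightarrow> \<gamma> \<le> Gamma (b + 1)"
    using Gamma_plus1_lower_bound[OF pos(3)] by blast
  define C' where "C' = C / (1 - exp (- a10))"
  have C': "0 < C'" using C pos by (simp add: C'_def)
  have ev_s0: "\<forall>\<^sub>F n in sequentially. s0 \<le> real n powr (1 / a3)" using pos by real_asymp
  have ev_r0: "\<forall>\<^sub>F n in sequentially. r0 \<le> real n powr (1 / tau3)" using pos by real_asymp
  have "(\<lambda>n. exp (- 2 * real n)) \<longlonglongrightarrow> 0" by real_asymp
  then have ev_\<delta>: "\<forall>\<^sub>F n in sequentially. exp (- 2 * real n) < \<delta>" using \<delta>(1) by (rule order_tendstoD)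
  \<comment> \<open>Eventually \<open>ln H \<ge> \<theta> / 2 * ln n\<close>, so
    \<open>H * ln H powr tau1\<close> is at least \<open>(\<theta> / 2) powr tau1 * n powr \<theta>
    * ln n powr (2 * t - 1 + tau1)\<close>; the \<open>- 1\<close> comes from the division by
    \<open>ln n\<close> in \<open>H\<close>. The hypothesis on \<open>t\<close> makes this power of
    the logarithm exceed \<open>2 * t0\<close>.\<close>
  have ev1: "\<forall>\<^sub>F n in sequentially. ln C' + c * (real n powr \<theta> * ln (real n) powr (2 * t0))
      \<le> (a10 * (\<theta> / 2) powr tau1) * (real n powr \<theta> * ln (real n) powr (2 * t - 1 + tau1))"
    using \<theta> pos t by (intro eventually_powr_ln_dominates) (auto simp: field_simps)
  \<comment> \<open>The polynomial factors in \<open>ev2\<close> to \<open>ev6\<close> come from the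
    union bounds: \<open>n\<^sup>2\<close> for the weights, with an additional
    \<open>n powr (2 * a)\<close> in the lower tail, none for the scale, and \<open>n\<close> for
    the means.\<close>
  have ev2: "\<forall>\<^sub>F n in sequentially. 2 powr a * real n powr 2 * exp (- (1 / 2) * real n) \<le> w n"
    unfolding w_def using \<theta> c by (intro eventually_exp_minus_le) auto
  have ev3: "\<forall>\<^sub>F n in sequentially. 1 / \<gamma> * real n powr (2 + 2 * a) * exp (- a * real n) \<le> w n"
    unfolding w_def using \<theta> c pos \<gamma> by (intro eventually_exp_minus_le) auto
  have ev4: "\<forall>\<^sub>F n in sequentially. a1 * real n powr 0 * exp (- a2 * real n) \<le> w n"
    unfolding w_def using \<theta> c pos by (intro eventually_exp_minus_le) auto
  have ev5: "\<forall>\<^sub>F n in sequentially. a4 * real n powr 0 * exp (- (2 * a5) * real n) \<le> w n"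
    unfolding w_def using \<theta> c pos by (intro eventually_exp_minus_le) auto
  have ev6: "\<forall>\<^sub>F n in sequentially. 1 * real n powr 1 * exp (- a13 * real n) \<le> w n"
    unfolding w_def using \<theta> c pos by (intro eventually_exp_minus_le) auto
  show ?thesis
    using ev_s0 ev_r0 ev_\<delta> ev1 ev2 ev3 ev4 ev5 ev6
      eventually_powr_ln_div_ln_le[OF \<theta>(2), of "2 * t"]
      eventually_ln_powr_ln_ge[OF \<theta>(1), of "2 * t"]
      eventually_powr_ln_div_ln_ge[OF \<theta>(1), of "exp 1" "2 * t"]
      eventually_ge_at_top[of 3]
  proof eventually_elim
    case (elim n)
    define H where "H = real n * (rate beta d t n)\<^sup>2 / ln (real n)"
    define h where "h = nat \<lfloor>H\<rfloor>"
    have n: "3 \<le> n" by fact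
    have H: "H = real n powr \<theta> * ln (real n) powr (2 * t) / ln (real n)"
      unfolding H_def \<theta>_def using n pos by (subst n_rate_squared) auto
    have wn: "w n = exp (- c * real n * (rate beta d t0 n)\<^sup>2)"
      unfolding w_def \<theta>_def using n pos n_rate_squared[of n beta d t0] by (simp add: mult.assoc)
    have He: "exp 1 \<le> H" and Hn: "H \<le> real n" using elim by (simp_all add: H)
    have H0: "0 < H" using He exp_gt_zero[of "1::real"] by linarith
    have mh: "m \<le> h \<longleftrightarrow> real m \<le> H" for m using H0 by (simp add: h_def le_nat_iff le_floor_iff)
    have hn: "real h \<le> real n" using mh[of h] Hn by simp
    have ln1: "1 \<le> ln (real n)" using He Hn n by (simp add: ln_ge_iff)

    define E1 where "E1 = {\<omega>\<in>space Pi. H < real (M \<omega>)}"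
    have E1: "prob E1 \<le> w n"
    proof -
      have "(\<theta> / 2) powr tau1 * ln (real n) powr tau1 = (\<theta> / 2 * ln (real n)) powr tau1"
        using \<theta> ln1 by (subst powr_mult) auto
      also have "\<dots> \<le> ln H powr tau1"
        using elim(11) \<theta> ln1 tau1 by (intro powr_mono2) (auto simp: H)
      finally have "a10 * ((\<theta> / 2) powr tau1 * ln (real n) powr tau1) * H \<le> a10 * ln H powr tau1 * H"
        using pos H0 by (intro mult_right_mono mult_left_mono) auto
      moreover have "a10 * ((\<theta> / 2) powr tau1 * ln (real n) powr tau1) * H
          = (a10 * (\<theta> / 2) powr tau1) * (real n powr \<theta> * ln (real n) powr (2 * t - 1 + tau1))"
        using ln1 by (simp add: H powr_add powr_diff)
      ultimately have *: "ln C' + - a10 * ln H powr tau1 * H \<le> - c * (real n powr \<theta> * ln (real n) powr (2 * t0))"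
        using elim(4) by simp
      have "prob E1 \<le> C' * exp (- a10 * ln H powr tau1 * H)"
        unfolding E1_def C'_def using C pos tau1 He
        by (intro component_count_tail prob meas_M) auto
      also have "\<dots> = exp (ln C' + - a10 * ln H powr tau1 * H)" unfolding exp_add using C' by simp
      also have "\<dots> \<le> w n" unfolding w_def using * by (simp only: exp_le_cancel_iff)
      finally show ?thesis .
    qed

    obtain E2 where E2: "E2 \<in> sets Pi" "{\<omega>\<in>space Pi. 1 \<le> M \<omega> \<and> real (M \<omega>) \<le> H \<and>
        \<not> ((\<forall>j<M \<omega>. exp (- real n * H) \<le> A \<omega> j) \<and> (\<Sum>j<M \<omega>. A \<omega> j) = 1)} \<subseteq> E2"
      "prob E2 \<le> real n powr 2 * (2 powr a * exp (- real n / 2) + exp (- a * real n) * real n powr (2 * a) / \<gamma>)"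
      using weight_tail[OF prob meas_M meas_A P4 pos(3) \<gamma> _ less_imp_le[OF H0] Hn] n by (meson le_trans one_le_numeral)
    note E2(3)
    also have "real n powr 2 * (2 powr a * exp (- real n / 2) + exp (- a * real n) * real n powr (2 * a) / \<gamma>)
        = 2 powr a * real n powr 2 * exp (- (1 / 2) * real n) + 1 / \<gamma> * real n powr (2 + 2 * a) * exp (- a * real n)"
      using n by (simp add: powr_add algebra_simps)
    finally have E2': "prob E2 \<le> 2 * w n" using elim(5,6) by linarith

    \<comment> \<open>In terms of the precision \<open>1 / (S \<omega>)\<^sup>2\<close> the lower
      scale cutoff becomes \<open>n powr (1 / a3)\<close>, whose power \<open>a3\<close> is
      \<open>n\<close>, and the upper one becomes \<open>exp (- 2 * n)\<close>.\<close>
    define E3 where "E3 = {\<omega>\<in>space Pi. real n powr (1 / a3) \<le> 1 / (S \<omega>)\<^sup>2}"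
    have "prob E3 \<le> a1 * exp (- a2 * (real n powr (1 / a3)) powr a3)"
      unfolding E3_def by (rule s0) (rule elim(1))
    then have E3: "prob E3 \<le> w n" using elim(7) pos n by (simp add: powr_powr)

    define E4 where "E4 = {\<omega>\<in>space Pi. 1 / (S \<omega>)\<^sup>2 < exp (- 2 * real n)}"
    have "prob E4 \<le> a4 * exp (- 2 * real n) powr a5"
      unfolding E4_def by (rule \<delta>(2)) (use elim(3) in auto)
    then have E4: "prob E4 \<le> w n" using elim(8) n by (simp add: powr_def mult_ac)

    define F where "F j = {\<omega>\<in>space Pi. \<forall>i. \<bar>MY \<omega> j $ i\<bar> \<le> real n powr (1 / tau3)}" for j
    have F: "F j \<in> sets Pi" for j
    proof -
      have "F j = (\<lambda>\<omega>. MY \<omega> j) -` cbox (\<chi> i. - (real n powr (1 / tau3))) (\<chi> i. real n powr (1 / tau3)) \<inter> space Pi"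
        by (auto simp: F_def mem_box_cart abs_le_iff minus_le_iff)
      then show ?thesis using measurable_sets[OF meas_MY] by simp
    qed
    \<comment> \<open>The union runs over \<open>j < h\<close> rather than
      \<open>j < M \<omega>\<close>: outside \<open>E1\<close> there are at most \<open>h\<close>
      components, so a union bound over the marginal tails of the means suffices.\<close>
    define E5 where "E5 = (\<Union>j<h. space Pi - F j)"
    have "prob E5 \<le> (\<Sum>j<h. prob (space Pi - F j))"
      unfolding E5_def using F by (intro finite_measure_subadditive_finite) auto
    also have "\<dots> \<le> (\<Sum>j<h. exp (- a13 * real n))"
    proof (intro sum_mono)
      fix j
      have "1 - prob (F j) \<le> exp (- a13 * (real n powr (1 / tau3)) powr tau3)"
        unfolding F_def by (rule r0) (rule elim(2))
      then show "prob (space Pi - F j) \<le> exp (- a13 * real n)"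
        using F pos n by (simp add: prob_compl powr_powr)
    qed
    also have "\<dots> \<le> real n * exp (- a13 * real n)" using hn by (simp add: mult_right_mono)
    finally have E5: "prob E5 \<le> w n" using elim(9) n by simp

    have m1: "E1 \<in> sets Pi" unfolding E1_def by measurable
    have m3: "E3 \<in> sets Pi" unfolding E3_def by measurable
    have m4: "E4 \<in> sets Pi" unfolding E4_def by measurable
    have m5: "E5 \<in> sets Pi" unfolding E5_def using F by (intro sets.finite_UN sets.Diff sets.top) auto
    note m = m1 m3 m4 m5
    define E where "E = E0 \<union> (E1 \<union> (E2 \<union> (E3 \<union> (E4 \<union> E5))))"
    have "prob E \<le> prob E0 + (prob E1 + (prob E2 + (prob E3 + (prob E4 + prob E5))))"
      unfolding E_def using m E2(1) E0(3)
      by (intro order_trans[OF measure_Un_le] add_left_mono order_refl sets.Un)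
    also have "prob E0 = 0" using E0(2) by (simp add: measure_def)
    finally have "prob E \<le> 6 * w n" using E1 E2' E3 E4 E5 by linarith
    moreover have "E \<in> sets Pi" unfolding E_def using m E2(1) E0(3) by auto
    \<comment> \<open>What remains is deterministic: parameters avoiding \<open>E0\<close> to
      \<open>E5\<close> satisfy every condition of the sieve. The weights are nonnegative because
      they are at least the positive cutoff.\<close>
    moreover have "{\<omega>\<in>space Pi. mix_dens (M \<omega>) (A \<omega>) (MY \<omega>) (MX \<omega>) (S \<omega>) \<notin> sieve beta d t a3 tau3 n} \<subseteq> E"
    proof (rule subsetI, rule ccontr)
      fix \<omega> assume \<omega>: "\<omega> \<in> {\<omega>\<in>space Pi. mix_dens (M \<omega>) (A \<omega>) (MY \<omega>) (MX \<omega>) (S \<omega>) \<notin> sieve beta d t a3 tau3 n}"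
        and "\<omega> \<notin> E"
      then have sp: "\<omega> \<in> space Pi" and nin: "\<omega> \<notin> E0" "\<omega> \<notin> E1" "\<omega> \<notin> E2" "\<omega> \<notin> E3" "\<omega> \<notin> E4" "\<omega> \<notin> E5" by (auto simp: E_def)
      have v0: "1 \<le> M \<omega>" "0 < S \<omega>" "\<And>j. MX \<omega> j \<in> unit_cube" using sp nin(1) E0(1) by auto
      have MH: "real (M \<omega>) \<le> H" using sp nin(2) by (simp add: E1_def)
      have al: "\<And>j. j < M \<omega> \<Longrightarrow> exp (- real n * H) \<le> A \<omega> j" "(\<Sum>j<M \<omega>. A \<omega> j) = 1"
        using sp nin(3) E2(2) v0(1) MH by auto
      have "0 \<le> A \<omega> j" if "j < M \<omega>" for j using al(1)[OF that] exp_gt_zero[of "- real n * H"] by linarith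
      then have v: "valid_param (M \<omega>) (A \<omega>) (MX \<omega>) (S \<omega>)" using v0 al by (simp add: valid_param_def)
      have "real n powr (- 1 / (2 * a3)) \<le> S \<omega>"
      proof (rule power2_le_imp_le)
        have "1 / (S \<omega>)\<^sup>2 < real n powr (1 / a3)" using sp nin(4) by (simp add: E3_def)
        then have "1 / real n powr (1 / a3) \<le> (S \<omega>)\<^sup>2" using v0(2) n by (simp add: field_simps)
        moreover have "(real n powr (- 1 / (2 * a3)))\<^sup>2 = real n powr (- (1 / a3))" using n by (subst powr_power) auto
        ultimately show "(real n powr (- 1 / (2 * a3)))\<^sup>2 \<le> (S \<omega>)\<^sup>2" by (simp add: powr_minus_divide)
      qed (use v0 in simp)
      moreover have "S \<omega> \<le> exp (real n)"
      proof (rule power2_le_imp_le)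
        have "exp (- 2 * real n) \<le> 1 / (S \<omega>)\<^sup>2" using sp nin(5) by (simp add: E4_def)
        then have "(S \<omega>)\<^sup>2 \<le> exp (2 * real n)" using v0(2) by (simp add: exp_minus field_simps)
        then show "(S \<omega>)\<^sup>2 \<le> (exp (real n))\<^sup>2" by (simp add: exp_double)
      qed simp
      moreover have "\<bar>MY \<omega> j $ i\<bar> \<le> real n powr (1 / tau3)" if "j < M \<omega>" for i j
      proof -
        have "j < h" using that mh[of "M \<omega>"] MH by simp
        then have "\<omega> \<in> F j" using sp nin(6) by (auto simp: E5_def)
        then show ?thesis by (simp add: F_def)
      qed
      ultimately have "sieve_cond beta d t a3 tau3 n (M \<omega>) (A \<omega>) (MY \<omega>) (S \<omega>)"
        unfolding sieve_cond_def Let_def H_def[symmetric] using MH al by simp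
      then have "mix_dens (M \<omega>) (A \<omega>) (MY \<omega>) (MX \<omega>) (S \<omega>) \<in> sieve beta d t a3 tau3 n"
        using v unfolding sieve_def by blast
      then show False using \<omega> by simp
    qed
    ultimately show ?case unfolding wn by blast
  qed
qed

section \<open>Combination of the entropy bound and the prior mass bound\<close>

theorem theorem5:
  fixes Pi :: "'p measure"
    and M :: "'p \<Rightarrow> nat" and A :: "'p \<Rightarrow> nat \<Rightarrow> real"
    and MY :: "'p \<Rightarrow> nat \<Rightarrow> real^'dy" and MX :: "'p \<Rightarrow> nat \<Rightarrow> real^'dx"
    and S :: "'p \<Rightarrow> real"
    and g0 :: "real^'dx \<Rightarrow> real"
    and beta tau t0 a a1 a2 a3 a4 a5 a6 a7 a8 a9 a10 a11 a12 a13 tau1 tau2 tau3 :: real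
  assumes prob: "prob_space Pi"
    and meas_M: "M \<in> measurable Pi (count_space UNIV)"
    and meas_A: "\<And>j. (\<lambda>\<omega>. A \<omega> j) \<in> borel_measurable Pi"
    and meas_S: "S \<in> borel_measurable Pi"
    and meas_MY: "\<And>j. (\<lambda>\<omega>. MY \<omega> j) \<in> borel_measurable Pi"
    and meas_MX: "\<And>j. (\<lambda>\<omega>. MX \<omega> j) \<in> borel_measurable Pi"
    and param_dom: "AE \<omega> in Pi. 1 \<le> M \<omega> \<and> 0 < S \<omega>"
    and g0_meas: "g0 \<in> borel_measurable borel"
    and g0_nonneg: "\<And>x. 0 \<le> g0 x"
    and g0_supp: "\<And>x. x \<notin> unit_cube \<Longrightarrow> g0 x = 0"
    and g0_int: "(\<integral>\<^sup>+ x. ennreal (g0 x) \<partial>lborel) = 1"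
    and pos: "0 < beta" "0 < tau" "0 < a" "0 < a1" "0 < a2" "0 < a3" "0 < a4" "0 < a5" "0 < a6"
             "0 < a7" "0 < a8" "0 < a9" "0 < a10" "0 < a11" "0 < a12" "0 < a13"
    and tau_pos: "0 \<le> tau1" "0 < tau2" "0 < tau3"
    and P1: "\<exists>s0. \<forall>s\<ge>s0. measure Pi {\<omega>\<in>space Pi. s \<le> 1 / (S \<omega>)\<^sup>2}
                   \<le> a1 * exp (- a2 * s powr a3)"
    and P2: "\<exists>\<delta>>0. \<forall>s. 0 < s \<and> s < \<delta> \<longrightarrow>
               measure Pi {\<omega>\<in>space Pi. 1 / (S \<omega>)\<^sup>2 < s} \<le> a4 * s powr a5"
    and P3: "\<And>s t. 0 < s \<Longrightarrow> 0 < t \<Longrightarrow> t < 1 \<Longrightarrow>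
               measure Pi {\<omega>\<in>space Pi. s < 1 / (S \<omega>)\<^sup>2 \<and> 1 / (S \<omega>)\<^sup>2 < s * (1 + t)}
               \<ge> a6 * s powr a7 * t powr a8 * exp (- a9 * sqrt s)"
    and P4: "\<And>i B. 1 \<le> i \<Longrightarrow> B \<in> sets (PiM {..<i} (\<lambda>_. lborel)) \<Longrightarrow>
               measure Pi {\<omega>\<in>space Pi. M \<omega> = i \<and> restrict (A \<omega>) {..<i} \<in> B}
               = measure Pi {\<omega>\<in>space Pi. M \<omega> = i} * measure (dirichlet i (a / real i)) B"
    and P5: "\<exists>C>0. \<forall>i::nat. 2 \<le> i \<longrightarrow>
               measure Pi {\<omega>\<in>space Pi. M \<omega> = i} = C * exp (- a10 * real i * ln (real i) powr tau1)"
    and P6_indep: "prob_space.indep_sets Pi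
               (\<lambda>k. case k of
                    Rest \<Rightarrow> gen_events Pi (\<lambda>\<omega>. (M \<omega>, A \<omega>, S \<omega>))
                              (count_space UNIV \<Otimes>\<^sub>M (PiM UNIV (\<lambda>_::nat. borel) \<Otimes>\<^sub>M (borel :: real measure)))
                  | MuY j \<Rightarrow> gen_events Pi (\<lambda>\<omega>. MY \<omega> j) borel
                  | MuX j \<Rightarrow> gen_events Pi (\<lambda>\<omega>. MX \<omega> j) borel) UNIV"
    and P6_x: "\<exists>c>0. \<forall>j. \<exists>h. distributed Pi lborel (\<lambda>\<omega>. MX \<omega> j) h
               \<and> (\<forall>x\<in>unit_cube. ennreal c \<le> h x) \<and> (\<forall>x. x \<notin> unit_cube \<longrightarrow> h x = 0)"
    and P6_y: "\<And>j. \<exists>h. distributed Pi lborel (\<lambda>\<omega>. MY \<omega> j) h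
               \<and> (\<forall>y. ennreal (a11 * exp (- a12 * norm y powr tau2)) \<le> h y)"
    and P6_tail: "\<exists>r0. \<forall>r\<ge>r0. \<forall>j.
               1 - measure Pi {\<omega>\<in>space Pi. \<forall>i. \<bar>MY \<omega> j $ i\<bar> \<le> r} \<le> exp (- a13 * r powr tau3)"
    and t0: "t0 > ((real (CARD('dy) + CARD('dx))) * (1 + 1 / beta + 1 / tau) + max tau1 (max 1 (tau2 / tau)))
               / (2 + real (CARD('dy) + CARD('dx)) / beta)"
  shows "\<forall>rho \<in> {dist_h g0, dist_1 g0}. \<forall>t. t > t0 + max 0 ((1 - tau1) / 2) \<longrightarrow>
           (\<exists>c1>0. \<exists>c3>0. \<forall>c2>0. \<forall>\<^sub>F n in sequentially.
              (let d = real (CARD('dy) + CARD('dx));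
                   Fn = sieve beta d t a3 tau3 n
               in (\<exists>k. covering_number (rate beta d t n) Fn rho cond_densities = enat k
                        \<and> ln (real k) \<le> c1 * real n * (rate beta d t n)\<^sup>2)
                \<and> (\<exists>E\<in>sets Pi. {\<omega>\<in>space Pi. mix_dens (M \<omega>) (A \<omega>) (MY \<omega>) (MX \<omega>) (S \<omega>) \<notin> Fn} \<subseteq> E
                        \<and> measure Pi E \<le> c3 * exp (- (c2 + 4) * real n * (rate beta d t0 n)\<^sup>2))))"
proof (intro ballI allI impI)
  fix rho :: "(real^'dy \<Rightarrow> real^'dx \<Rightarrow> real) \<Rightarrow> (real^'dy \<Rightarrow> real^'dx \<Rightarrow> real) \<Rightarrow> real" and t
  assume rho: "rho \<in> {dist_h g0, dist_1 g0}" and t: "t0 + max 0 ((1 - tau1) / 2) < t"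
  let ?d = "real (CARD('dy) + CARD('dx))"
  have d: "0 < ?d" by (simp add: add_pos_pos)
  have "\<exists>c1>0. \<forall>\<^sub>F n in sequentially.
      \<exists>k. covering_number (rate beta ?d t n) (sieve beta ?d t a3 tau3 n) rho cond_densities = enat k
        \<and> ln (real k) \<le> c1 * real n * (rate beta ?d t n)\<^sup>2"
    by (rule sieve_entropy[where ?g0.0 = g0]) (rule pos tau_pos g0_meas g0_nonneg g0_supp g0_int rho | assumption)+
  then obtain c1 where c1: "0 < c1" and entropy: "\<forall>\<^sub>F n in sequentially.
      \<exists>k. covering_number (rate beta ?d t n) (sieve beta ?d t a3 tau3 n) rho cond_densities = enat k
        \<and> ln (real k) \<le> c1 * real n * (rate beta ?d t n)\<^sup>2"
    by (elim exE conjE)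
  have x: "\<exists>h. distributed Pi lborel (\<lambda>\<omega>. MX \<omega> j) h \<and> (\<forall>x. x \<notin> unit_cube \<longrightarrow> h x = 0)" for j
    using P6_x by blast
  have t': "t0 + (1 - tau1) / 2 < t" using t by linarith
  \<comment> \<open>The prior mass bound is applied with \<open>c = c2 + 4\<close>; its factor 6 is
    the same for every \<open>c2\<close>, so \<open>c3 = 6\<close> can be fixed before
    \<open>c2\<close>.\<close>
  have mass: "\<forall>\<^sub>F n in sequentially. \<exists>E\<in>sets Pi.
      {\<omega>\<in>space Pi. mix_dens (M \<omega>) (A \<omega>) (MY \<omega>) (MX \<omega>) (S \<omega>) \<notin> sieve beta ?d t a3 tau3 n} \<subseteq> E
      \<and> measure Pi E \<le> 6 * exp (- (c2 + 4) * real n * (rate beta ?d t0 n)\<^sup>2)" if "0 < c2" for c2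
  proof (rule sieve_prior_mass[where a = a and ?a1.0 = a1 and ?a2.0 = a2 and ?a4.0 = a4 and ?a5.0 = a5
        and ?a10.0 = a10 and ?a13.0 = a13 and ?tau1.0 = tau1])
    show "0 < c2 + 4" using that by simp
  qed (rule prob meas_M meas_A meas_S meas_MY meas_MX param_dom pos tau_pos d P1 P2 P4 P5 x P6_tail t' | assumption)+
  show "\<exists>c1>0. \<exists>c3>0. \<forall>c2>0. \<forall>\<^sub>F n in sequentially.
              (let d = ?d; Fn = sieve beta d t a3 tau3 n
               in (\<exists>k. covering_number (rate beta d t n) Fn rho cond_densities = enat k
                        \<and> ln (real k) \<le> c1 * real n * (rate beta d t n)\<^sup>2)
                \<and> (\<exists>E\<in>sets Pi. {\<omega>\<in>space Pi. mix_dens (M \<omega>) (A \<omega>) (MY \<omega>) (MX \<omega>) (S \<omega>) \<notin> Fn} \<subseteq> E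
                        \<and> measure Pi E \<le> c3 * exp (- (c2 + 4) * real n * (rate beta d t0 n)\<^sup>2)))"
    unfolding Let_def
  proof (rule exI[of _ c1], rule conjI[OF c1], rule exI[of _ 6], rule conjI, simp, intro allI impI)
    fix c2 :: real assume "0 < c2"
    show "\<forall>\<^sub>F n in sequentially.
        (\<exists>k. covering_number (rate beta ?d t n) (sieve beta ?d t a3 tau3 n) rho cond_densities = enat k
              \<and> ln (real k) \<le> c1 * real n * (rate beta ?d t n)\<^sup>2)
        \<and> (\<exists>E\<in>sets Pi. {\<omega>\<in>space Pi. mix_dens (M \<omega>) (A \<omega>) (MY \<omega>) (MX \<omega>) (S \<omega>) \<notin> sieve beta ?d t a3 tau3 n} \<subseteq> E
              \<and> measure Pi E \<le> 6 * exp (- (c2 + 4) * real n * (rate beta ?d t0 n)\<^sup>2))"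
      by (rule eventually_conj[OF entropy mass[OF \<open>0 < c2\<close>]])
  qed
qed

end
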